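(* Let $A$ be a fixed finite alphabet. There is an algorithm that, given as input the trie recognizing the set $\mathcal{M}_{[w]}$ of minimal forbidden factors of a primitive circular word $[w]$ over $A$, outputs the circular word $[w]$ (that is, one of its linearizations) in time linear in $|w|$.
   Context: Words are elements of the free monoid $A^*$; $|w|$ is the length of $w$. A circular word $[w]$ is the conjugacy class of $w$ (the set of all rotations $vu$ of $w=uv$); any element of the class is a linearization of $[w]$. A word $w$ is primitive if $w=v^k$ implies $k=1$; primitivity is invariant under conjugacy, and $[w]$ is primitive if $w$ is. The set of factors of $[w]$ is $\mathcal{F}_{w^*}$, the set of all words that are factors (contiguous subwords, including the empty word $\varepsilon$) of $w^k$ for some $k\ge0$; it does not depend on the linearization. For a language $L$ closed under taking factors, the set of minimal forbidden factors is $$\mathcal{M}_L=\{a\in A\mid a\notin L\}\cup\{aub\mid a,b\in A,\ u\in A^*,\ aub\notin L,\ au\in L,\ ub\in L\},$$ and $\mathcal{M}_{[w]}:=\mathcal{M}_{\mathcal{F}_{w^*}}$ (a finite set). The trie recognizing a finite language $M$ in which no word is a proper factor of another is the tree-like deterministic automaton whose states are the prefixes of words of $M$ (with root $\varepsilon$ as initial state), whose terminal states are the words of $M$, and whose transitions are $u\xrightarrow{a}ua$ whenever $u$ and $ua$ are both states. Running time is measured in the standard RAM model, the trie being given as an explicit graph. *)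

theory Defs
  imports Complex_Main "HOL-Library.Sublist"
begin

section \<open>Circular words and minimal forbidden factors\<close>

definition word_pow :: "'a list \<Rightarrow> nat \<Rightarrow> 'a list" where
  "word_pow w k = concat (replicate k w)"

text \<open>The empty word is not primitive, being its own square.\<close>

definition primitive_word :: "'a list \<Rightarrow> bool" where
  "primitive_word w \<longleftrightarrow> (\<forall>v k. w = word_pow v k \<longrightarrow> k = 1)"

definition circular_word :: "'a list \<Rightarrow> 'a list set" where
  "circular_word w = {v @ u | u v. w = u @ v}"

definition circular_factors :: "'a list \<Rightarrow> 'a list set" where
  "circular_factors w = {x. \<exists>k. sublist x (word_pow w k)}"

definition minimal_forbidden :: "'a set \<Rightarrow> 'a list set \<Rightarrow> 'a list set" where
  "minimal_forbidden A L =
     {[a] | a. a \<in> A \<and> [a] \<notin> L} \<union>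
     {[a] @ u @ [b] | a u b. a \<in> A \<and> b \<in> A \<and> u \<in> lists A \<and>
        [a] @ u @ [b] \<notin> L \<and> [a] @ u \<in> L \<and> u @ [b] \<in> L}"

section \<open>Tries\<close>

record ('q, 'a) automaton =
  states :: "'q set"
  init :: 'q
  final :: "'q set"
  trans :: "'q \<Rightarrow> 'a \<Rightarrow> 'q option"

text \<open>The root is a state even if \<open>M\<close> is empty, which happens for \<open>M = \<M>\<^bsub>[w]\<^esub>\<close>
  exactly when the alphabet is a singleton.\<close>

definition trie_states :: "'a list set \<Rightarrow> 'a list set" where
  "trie_states M = insert [] {u. \<exists>m\<in>M. prefix u m}"

definition trie :: "'a list set \<Rightarrow> ('a list, 'a) automaton" where
  "trie M = \<lparr> states = trie_states M, init = [], final = M,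
     trans = (\<lambda>u a. if u \<in> trie_states M \<and> u @ [a] \<in> trie_states M
                    then Some (u @ [a]) else None) \<rparr>"

text \<open>
  An automaton over \<open>A\<close> as an explicit graph, laid out as a sequence of numbers. The states
  are numbered from 0 in an arbitrary way \<open>num\<close>, the letters by \<open>code\<close>. The sequence
  consists of the number of states, the number of the initial state, and then, for each state in
  the order of \<open>num\<close>, a record of \<open>1 + card A\<close> cells: a flag telling whether the state
  is terminal, followed by one cell for each letter, which is 0 if there is no transition by this
  letter and otherwise one more than the number of its target.
\<close>

definition encodes_graph ::
    "'a set \<Rightarrow> ('a \<Rightarrow> nat) \<Rightarrow> ('q, 'a) automaton \<Rightarrow> nat list \<Rightarrow> bool" where
  "encodes_graph A code T xs \<longleftrightarrow>
     (\<exists>num. bij_betw num (states T) {..<card (states T)} \<and>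
        length xs = 2 + card (states T) * (1 + card A) \<and>
        xs ! 0 = card (states T) \<and>
        xs ! 1 = num (init T) \<and>
        (\<forall>q \<in> states T.
           xs ! (2 + num q * (1 + card A)) = (if q \<in> final T then 1 else 0) \<and>
           (\<forall>a \<in> A. xs ! (2 + num q * (1 + card A) + 1 + code a) =
              (case trans T q a of None \<Rightarrow> 0 | Some q' \<Rightarrow> num q' + 1))))"

section \<open>Random access machines\<close>

text \<open>
  A program is a list of instructions over registers, which are named by constants, and a memory,
  which is addressed by register contents. Every instruction takes one unit of time. The machine
  halts when the program counter leaves the program; \<open>step\<close> then leaves the configuration
  unchanged.
\<close>

datatype arith = Add | Sub | Mul | Div

datatype instr =
    Const nat nat
  | Move nat nat
  | Arith arith nat nat nat
  | Load nat nat
  | Store nat nat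
  | Jump nat
  | JumpZero nat nat

record config =
  pc :: nat
  reg :: "nat \<Rightarrow> nat"
  mem :: "nat \<Rightarrow> nat"

text \<open>Subtraction is truncated at 0, and division by 0 yields 0.\<close>

fun arith_val :: "arith \<Rightarrow> nat \<Rightarrow> nat \<Rightarrow> nat" where
  "arith_val Add x y = x + y"
| "arith_val Sub x y = x - y"
| "arith_val Mul x y = x * y"
| "arith_val Div x y = x div y"

fun exec_instr :: "instr \<Rightarrow> config \<Rightarrow> config" where
  "exec_instr (Const r n) c = c\<lparr>pc := pc c + 1, reg := (reg c)(r := n)\<rparr>"
| "exec_instr (Move r s) c = c\<lparr>pc := pc c + 1, reg := (reg c)(r := reg c s)\<rparr>"
| "exec_instr (Arith f r s t) c =
     c\<lparr>pc := pc c + 1, reg := (reg c)(r := arith_val f (reg c s) (reg c t))\<rparr>"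
| "exec_instr (Load r s) c = c\<lparr>pc := pc c + 1, reg := (reg c)(r := mem c (reg c s))\<rparr>"
| "exec_instr (Store r s) c = c\<lparr>pc := pc c + 1, mem := (mem c)(reg c r := reg c s)\<rparr>"
| "exec_instr (Jump l) c = c\<lparr>pc := l\<rparr>"
| "exec_instr (JumpZero r l) c = c\<lparr>pc := (if reg c r = 0 then l else pc c + 1)\<rparr>"

definition halted :: "instr list \<Rightarrow> config \<Rightarrow> bool" where
  "halted P c \<longleftrightarrow> length P \<le> pc c"

definition step :: "instr list \<Rightarrow> config \<Rightarrow> config" where
  "step P c = (if halted P c then c else exec_instr (P ! pc c) c)"

definition initial_config :: "nat list \<Rightarrow> config" where
  "initial_config xs =
     \<lparr> pc = 0, reg = (\<lambda>_. 0), mem = (\<lambda>i. if i < length xs then xs ! i else 0) \<rparr>"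

text \<open>The output is an array in memory, with its address in register 0 and its length in
  register 1.\<close>

definition has_output :: "config \<Rightarrow> nat list \<Rightarrow> bool" where
  "has_output c ys \<longleftrightarrow>
     reg c 1 = length ys \<and> (\<forall>i < length ys. mem c (reg c 0 + i) = ys ! i)"

definition fits :: "nat \<Rightarrow> config \<Rightarrow> bool" where
  "fits B c \<longleftrightarrow> (\<forall>r. reg c r \<le> B) \<and> (\<forall>i. mem c i \<le> B)"

text \<open>
  Unit cost is only realistic if machine words are short: all numbers that occur during the run
  must be at most \<open>B\<close>. Taking \<open>B\<close> polynomial in the size of the input gives words of
  logarithmically many bits.
\<close>

definition computes_within ::
    "instr list \<Rightarrow> nat \<Rightarrow> nat list \<Rightarrow> nat \<Rightarrow> nat list \<Rightarrow> bool" where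
  "computes_within P B xs t ys \<longleftrightarrow>
     (\<forall>i \<le> t. fits B ((step P ^^ i) (initial_config xs))) \<and>
     halted P ((step P ^^ t) (initial_config xs)) \<and>
     has_output ((step P ^^ t) (initial_config xs)) ys"

end

theory Submission
  imports Defs "HOL-Number_Theory.Cong"
begin

text \<open>
  A factor \<open>x\<close> of \<open>[w]\<close> stays a factor after appending a letter
  \<open>a\<close> iff the longest suffix of \<open>xa\<close> that is a state of the trie is not
  terminal. The Aho-Corasick construction turns the trie into an automaton that keeps track of this
  suffix; it treats the states in breadth-first order, so that the failure state is complete when it
  is needed. Always taking the first admissible letter yields a walk that, after as many steps as
  there are states, is on a cycle. Its label, repeated forever, consists of factors of
  \<open>[w]\<close>, so by primitivity the length of the cycle is a multiple of \<open>|w|\<close>;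
  since a state depends on boundedly many letters, the length is \<open>|w|\<close> and the label is
  a rotation of \<open>w\<close>.

  The trie has \<open>O(|w|)\<close> states: distinct proper prefixes of minimal forbidden words end
  at distinct sets of positions of the circle, and these sets form a laminar family on
  \<open>|w|\<close> points.
\<close>

text \<open>The program is never told \<open>length w\<close>, yet its time must be linear in it.
  The number of states is the only clock at hand: it fixes how long the walk runs before output
  starts, so the size of the trie has to be bounded, and the end of the output is found by comparing
  states. Terminal states occur nowhere on the circle and escape the laminar count; each is charged
  to its parent, which brings a factor \<open>1 + card A\<close> into the size of the trie. Another
  obstacle is that the walk is only known to spell a factor over every finite stretch, possibly at a
  starting position that changes with the length of the stretch. Hence the letters of the walk are
  never identified with a rotation outright; one stretch is fixed that is long enough for both
  directions of the period argument.\<close>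

section \<open>Laminar families\<close>

text \<open>Delete a point \<open>x\<close> from every member. Two members are merged only if they
  are \<open>X\<close> and \<open>X - {x}\<close>, and laminarity allows one such \<open>X\<close>;
  besides, \<open>{x}\<close> becomes empty. So each point accounts for at most two sets.\<close>

lemma card_laminar_le:
  assumes "finite S" and "\<And>X. X \<in> \<F> \<Longrightarrow> X \<subseteq> S \<and> X \<noteq> {}"
    and "\<And>X Y. X \<in> \<F> \<Longrightarrow> Y \<in> \<F> \<Longrightarrow> X \<inter> Y = {} \<or> X \<subseteq> Y \<or> Y \<subseteq> X"
  shows "card \<F> \<le> 2 * card S"
  using assms
proof (induction S arbitrary: \<F> rule: finite_induct)
  case empty
  then have "\<F> = {}" by blast
  then show ?case by simp
next
  case (insert x S)
  have fin: "finite \<F>"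
    by (rule finite_subset[of _ "Pow (insert x S)"]) (use insert.prems(1) insert.hyps in auto)
  define \<G> where "\<G> = (\<lambda>X. X - {x}) ` \<F> - {{}}"
  define \<C> where "\<C> = {X \<in> \<F>. x \<in> X \<and> X - {x} \<in> \<F>}"
  define \<H> where "\<H> = \<F> - insert {x} \<C>"
  have \<G>: "card \<G> \<le> 2 * card S"
  proof (rule insert.IH)
    fix X assume "X \<in> \<G>"
    then show "X \<subseteq> S \<and> X \<noteq> {}" using insert.prems(1) by (fastforce simp: \<G>_def)
  next
    fix X Y assume "X \<in> \<G>" "Y \<in> \<G>"
    then obtain X' Y' where "X' \<in> \<F>" "Y' \<in> \<F>" "X = X' - {x}" "Y = Y' - {x}"
      by (auto simp: \<G>_def)
    then show "X \<inter> Y = {} \<or> X \<subseteq> Y \<or> Y \<subseteq> X" using insert.prems(2)[of X' Y'] by blast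
  qed
  have fin_C: "finite \<C>" using fin by (simp add: \<C>_def)
  \<comment> \<open>Neither of \<open>X\<close>, \<open>Y\<close> lies inside the other one without
    \<open>x\<close>, but they share points other than \<open>x\<close>; laminarity of the mixed
    pairs then gives both inclusions.\<close>
  have "X = Y" if "X \<in> \<C>" "Y \<in> \<C>" for X Y
  proof -
    have mem: "X \<in> \<F>" "Y \<in> \<F>" "X - {x} \<in> \<F>" "Y - {x} \<in> \<F>" and x: "x \<in> X" "x \<in> Y"
      using that by (auto simp: \<C>_def)
    have "X - {x} \<noteq> {}" "Y - {x} \<noteq> {}" using mem insert.prems(1) by blast+
    then show ?thesis
      using insert.prems(2)[OF mem(1,2)] insert.prems(2)[OF mem(1,4)] insert.prems(2)[OF mem(2,3)] x
      by blast
  qed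
  then have "card \<C> \<le> 1" using fin_C by (simp add: card_le_Suc0_iff_eq)
  then have "card (insert {x} \<C>) \<le> 2" using fin_C by (simp add: card_insert_if)
  moreover have "card \<H> \<le> card \<G>"
  proof (rule card_inj_on_le)
    show "inj_on (\<lambda>X. X - {x}) \<H>"
    proof (rule inj_onI)
      fix X Y assume XY: "X \<in> \<H>" "Y \<in> \<H>" "X - {x} = Y - {x}"
      show "X = Y"
      proof (cases "x \<in> X \<longleftrightarrow> x \<in> Y")
        case True then show ?thesis using XY(3) by blast
      next
        case False
        then consider "x \<in> X" "X - {x} = Y" | "x \<in> Y" "Y - {x} = X" using XY(3) by blast
        then show ?thesis using XY(1,2) unfolding \<H>_def \<C>_def by cases blast+
      qed
    qed
    show "(\<lambda>X. X - {x}) ` \<H> \<subseteq> \<G>"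
    proof (rule image_subsetI)
      fix X assume "X \<in> \<H>"
      then have "X \<in> \<F>" "X \<noteq> {x}" "X \<noteq> {}" using insert.prems(1) by (auto simp: \<H>_def)
      then show "X - {x} \<in> \<G>" by (auto simp: \<G>_def)
    qed
    show "finite \<G>" using fin by (simp add: \<G>_def)
  qed
  moreover have "card \<F> \<le> card \<H> + card (insert {x} \<C>)"
  proof -
    have "card \<F> \<le> card (\<H> \<union> insert {x} \<C>)"
      by (rule card_mono) (use fin fin_C in \<open>auto simp: \<H>_def\<close>)
    then show ?thesis using card_Un_le[of \<H> "insert {x} \<C>"] by linarith
  qed
  ultimately show ?case using \<G> insert.hyps by simp
qed

section \<open>The longest suffix in a prefix-closed language\<close>

text \<open>On a trie this is the state of the Aho-Corasick automaton after reading a word. The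
  default \<open>[]\<close> is the root.\<close>

primrec longest_suffix_in :: "'a list set \<Rightarrow> 'a list \<Rightarrow> 'a list" where
  "longest_suffix_in S [] = []"
| "longest_suffix_in S (a # x) = (if a # x \<in> S then a # x else longest_suffix_in S x)"

lemma longest_suffix_in_mem: "[] \<in> S \<Longrightarrow> longest_suffix_in S x \<in> S"
  by (induction x) auto

lemma suffix_longest_suffix_in: "suffix (longest_suffix_in S x) x"
  by (induction x) (auto simp: suffix_Cons)

lemma longest_suffix_in_id: "x \<in> S \<Longrightarrow> longest_suffix_in S x = x"
  by (cases x) auto

lemma suffix_imp_suffix_longest:
  "suffix v x \<Longrightarrow> v \<in> S \<Longrightarrow> suffix v (longest_suffix_in S x)"
  by (induction x) (auto simp: suffix_Cons)

text \<open>A letter dropped from the front can never help later: prefix closure turns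
  \<open>b # x \<notin> S\<close> into \<open>b # x @ [a] \<notin> S\<close>. So the automaton may
  forget everything but its state.\<close>

lemma longest_suffix_in_snoc:
  assumes "\<And>u v. u @ v \<in> S \<Longrightarrow> u \<in> S"
  shows "longest_suffix_in S (longest_suffix_in S x @ [a]) = longest_suffix_in S (x @ [a])"
proof (induction x)
  case (Cons b x)
  have "b # x @ [a] \<notin> S" if "b # x \<notin> S" using assms[of "b # x" "[a]"] that by auto
  then show ?case using Cons by auto
qed simp

text \<open>Supplies the bounded memory of the automaton: what precedes \<open>y\<close> is
  forgotten once the state is known to be no longer than \<open>y\<close>.\<close>

lemma longest_suffix_in_append:
  assumes "length (longest_suffix_in S (x @ y)) \<le> length y"
  shows "longest_suffix_in S (x @ y) = longest_suffix_in S y"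
  using assms
proof (induction x)
  case (Cons a x)
  then show ?case by (auto split: if_splits)
qed simp

section \<open>Factors of a primitive circular word\<close>

lemma length_word_pow: "length (word_pow w k) = k * length w"
  by (induction k) (auto simp: word_pow_def)

lemma nth_word_pow: "i < k * length w \<Longrightarrow> word_pow w k ! i = w ! (i mod length w)"
proof (induction k arbitrary: i)
  case (Suc k)
  have eq: "word_pow w (Suc k) = w @ word_pow w k" by (simp add: word_pow_def)
  show ?case
  proof (cases "i < length w")
    case False
    then have "word_pow w k ! (i - length w) = w ! ((i - length w) mod length w)"
      using Suc by auto
    then show ?thesis using False by (simp add: eq nth_append le_mod_geq)
  qed (simp add: eq nth_append)
qed simp

locale primitive_circular =
  fixes A :: "'a set" and w :: "'a list"
  assumes finite_alphabet: "finite A" and in_lists: "w \<in> lists A" and primitive: "primitive_word w"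
begin

text \<open>The circle is unrolled into an infinite sequence, so that factors become windows and
  wrapping around needs no case distinction.\<close>

definition letter :: "nat \<Rightarrow> 'a" where "letter i = w ! (i mod length w)"

definition window :: "nat \<Rightarrow> nat \<Rightarrow> 'a list" where "window i l = map letter [i..<i + l]"

abbreviation "F \<equiv> circular_factors w"
abbreviation "M \<equiv> minimal_forbidden A F"
abbreviation "S \<equiv> trie_states M"

lemma length_pos: "0 < length w"
proof (rule ccontr)
  assume "\<not> 0 < length w"
  then have "w = word_pow w 2" by (simp add: word_pow_def)
  then show False using primitive unfolding primitive_word_def by (metis numeral_eq_one_iff semiring_norm(85))
qed

lemma length_window [simp]: "length (window i l) = l"
  by (simp add: window_def)

lemma nth_window [simp]: "j < l \<Longrightarrow> window i l ! j = letter (i + j)"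
  by (simp add: window_def)

lemma window_add: "window i (l + l') = window i l @ window (i + l) l'"
  by (rule nth_equalityI) (auto simp: nth_append add.assoc)

lemma window_append_iff: "window i l = u @ v \<longleftrightarrow>
    l = length u + length v \<and> u = window i (length u) \<and> v = window (i + length u) (length v)"
  by (metis append_eq_append_conv length_append length_window window_add)

lemma letter_cong: "[i = j] (mod length w) \<Longrightarrow> letter i = letter j"
  by (simp add: letter_def cong_def)

lemma window_cong:
  assumes "[i = j] (mod length w)" shows "window i l = window j l"
  by (rule nth_equalityI) (use assms in \<open>auto intro!: letter_cong cong_add\<close>)

lemma letter_in: "letter i \<in> A"
  using in_lists length_pos by (auto simp: letter_def)

lemma word_pow_window: "word_pow w k = window 0 (k * length w)"
  by (rule nth_equalityI) (auto simp: length_word_pow nth_word_pow letter_def)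

lemma factor_iff: "x \<in> F \<longleftrightarrow> (\<exists>i. x = window i (length x))"
proof
  assume "x \<in> F"
  then obtain k u v where "window 0 (k * length w) = u @ x @ v"
    by (auto simp: circular_factors_def sublist_def word_pow_window)
  then have "x @ v = window (0 + length u) (length (x @ v))" unfolding window_append_iff by blast
  then have "window (0 + length u) (length (x @ v)) = x @ v" by (rule sym)
  then show "\<exists>i. x = window i (length x)" unfolding window_append_iff by blast
next
  assume "\<exists>i. x = window i (length x)"
  then obtain i where i: "x = window i (length x)" ..
  \<comment> \<open>As \<open>w\<close> is nonempty, this many copies of \<open>w\<close> reach at
    least to the end of the window.\<close>
  define k where "k = i + length x"
  define r where "r = k * length w - k"
  have "k * length w = i + length x + r"
    using length_pos unfolding r_def k_def by (cases "length w") auto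
  then have "word_pow w k = window 0 i @ x @ window (i + length x) r"
    using i by (simp add: word_pow_window window_add)
  then show "x \<in> F" unfolding circular_factors_def sublist_def by blast
qed

lemma window_factor: "window i l \<in> F"
  by (auto simp: factor_iff)

lemma factor_appendD:
  assumes "u @ v \<in> F" shows "u \<in> F" "v \<in> F"
proof -
  obtain k where k: "sublist (u @ v) (word_pow w k)"
    using assms by (auto simp: circular_factors_def)
  show "u \<in> F" "v \<in> F"
    unfolding circular_factors_def using sublist_order.order.trans[OF _ k] by blast+
qed

lemma factor_suffixD: "x \<in> F \<Longrightarrow> suffix u x \<Longrightarrow> u \<in> F"
  by (metis factor_appendD(2) suffix_def)

lemma Nil_factor: "[] \<in> F"
  using window_factor[of 0 0] by (simp add: window_def)

text \<open>On a circle every occurrence has a right neighbour, so the walk never gets stuck and the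
  minimum in \<open>next_code\<close> exists.\<close>

lemma factor_extend:
  assumes "x \<in> F" obtains a where "a \<in> A" "x @ [a] \<in> F"
proof -
  obtain i where i: "x = window i (length x)" using assms factor_iff by blast
  have "window i (length x + 1) = x @ [letter (i + length x)]"
    using i by (subst window_add) (simp add: window_def)
  then show ?thesis using that letter_in window_factor by metis
qed

lemma window_lists: "window i l \<in> lists A"
  by (auto simp: window_def letter_in)

lemma factor_lists: "x \<in> F \<Longrightarrow> x \<in> lists A"
  using window_lists by (metis factor_iff)

subsection \<open>Minimal forbidden factors\<close>

text \<open>Treats single letters and longer words alike: for a single letter,
  \<open>butlast\<close> and \<open>tl\<close> give the empty word, which is a factor.\<close>

lemma minimal_forbidden_iff:
  "m \<in> M \<longleftrightarrow> m \<in> lists A \<and> m \<noteq> [] \<and> m \<notin> F \<and> butlast m \<in> F \<and> tl m \<in> F"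
proof
  assume "m \<in> M"
  then show "m \<in> lists A \<and> m \<noteq> [] \<and> m \<notin> F \<and> butlast m \<in> F \<and> tl m \<in> F"
    unfolding minimal_forbidden_def using Nil_factor by (auto simp: butlast_append)
next
  assume m: "m \<in> lists A \<and> m \<noteq> [] \<and> m \<notin> F \<and> butlast m \<in> F \<and> tl m \<in> F"
  show "m \<in> M"
  proof (cases "tl m")
    case Nil
    then have "m = [hd m]" using m by (metis list.collapse)
    then show ?thesis using m unfolding minimal_forbidden_def by (metis (mono_tags, lifting) CollectI Cons_in_lists_iff UnI1)
  next
    case (Cons c y)
    then obtain a u b where "m = [a] @ u @ [b]"
      by (metis append_Cons append_Nil list.collapse list.distinct(1) rev_exhaust tl_Nil)
    then show ?thesis using m by (auto simp: minimal_forbidden_def butlast_append)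
  qed
qed

text \<open>Strip letters from the front as long as the rest stays forbidden. The last forbidden
  word is minimal, because its \<open>butlast\<close> is a suffix of the factor
  \<open>x\<close>.\<close>

lemma forbidden_suffix:
  assumes "x \<in> F" "a \<in> A" "x @ [a] \<notin> F"
  obtains m where "m \<in> M" "suffix m (x @ [a])"
  using assms
proof (induction x arbitrary: thesis)
  case Nil
  then have "[a] \<in> M" by (simp add: minimal_forbidden_iff)
  then show ?case using Nil by auto
next
  case (Cons b x)
  have x: "x \<in> F" using factor_appendD(2)[of "[b]" x] Cons.prems by simp
  show ?case
  proof (cases "x @ [a] \<in> F")
    case True
    then have "b # x @ [a] \<in> M"
      using Cons.prems factor_lists[of "b # x"] by (simp add: minimal_forbidden_iff butlast_append)
    then show ?thesis using Cons.prems(1)[of "b # x @ [a]"] by simp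
  next
    case False
    then obtain m where "m \<in> M" "suffix m (x @ [a])" using Cons.IH x Cons.prems by blast
    then show ?thesis using Cons.prems(1)[of m] by (simp add: suffix_Cons)
  qed
qed

section \<open>States of the trie and the test for being a factor\<close>

lemma Nil_state: "[] \<in> S"
  by (simp add: trie_states_def)

lemma state_appendD: "u @ v \<in> S \<Longrightarrow> u \<in> S"
  by (auto simp: trie_states_def dest: append_prefixD)

lemma minimal_forbidden_state: "m \<in> M \<Longrightarrow> m \<in> S"
  by (auto simp: trie_states_def)

lemma state_lists: "u \<in> S \<Longrightarrow> u \<in> lists A"
  by (auto simp: trie_states_def minimal_forbidden_iff prefix_def)

lemma state_cases:
  assumes "u \<in> S"
  obtains "u \<in> M" | "u = []" | v where "u @ v \<in> M" "v \<noteq> []"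
  using assms unfolding trie_states_def by (auto elim!: prefixE) (metis append_Nil2)

text \<open>A state that properly extends to a minimal forbidden word is a prefix of the
  \<open>butlast\<close> of that word, hence a factor.\<close>

lemma terminal_iff: "u \<in> S \<Longrightarrow> u \<in> M \<longleftrightarrow> u \<notin> F"
proof (erule state_cases)
  fix v assume "u @ v \<in> M" "v \<noteq> []"
  then have "u @ butlast v \<in> F" by (auto simp: minimal_forbidden_iff butlast_append)
  then show ?thesis by (auto simp: minimal_forbidden_iff dest: factor_appendD)
qed (auto simp: minimal_forbidden_iff Nil_factor)

abbreviation "longest \<equiv> longest_suffix_in S"

lemma longest_snoc: "longest (longest x @ [a]) = longest (x @ [a])"
  by (rule longest_suffix_in_snoc) (rule state_appendD)

lemma longest_state: "longest x \<in> S"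
  by (rule longest_suffix_in_mem) (rule Nil_state)

text \<open>If \<open>x @ [a]\<close> is forbidden, it has a minimal forbidden suffix. This suffix
  is a state, so the longest state contains it, is forbidden as well and therefore terminal.\<close>

lemma snoc_factor_iff:
  assumes "x \<in> F" "a \<in> A"
  shows "x @ [a] \<in> F \<longleftrightarrow> longest (x @ [a]) \<notin> M"
proof
  assume "x @ [a] \<in> F"
  then have "longest (x @ [a]) \<in> F" by (rule factor_suffixD) (rule suffix_longest_suffix_in)
  then show "longest (x @ [a]) \<notin> M" by (simp add: minimal_forbidden_iff)
next
  assume *: "longest (x @ [a]) \<notin> M"
  show "x @ [a] \<in> F"
  proof (rule ccontr)
    assume "x @ [a] \<notin> F"
    then obtain m where m: "m \<in> M" "suffix m (x @ [a])" using forbidden_suffix assms by blast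
    then have "suffix m (longest (x @ [a]))"
      by (simp add: suffix_imp_suffix_longest minimal_forbidden_state)
    then have "longest (x @ [a]) \<notin> F" using m(1) factor_suffixD minimal_forbidden_iff by blast
    then show False using * terminal_iff longest_state by blast
  qed
qed

subsection \<open>The size of the trie\<close>

text \<open>The end-position sets known from suffix automata, taken on the circle. Ends rather than
  starts are recorded because words with a common end are comparable as suffixes.\<close>

definition end_positions :: "'a list \<Rightarrow> nat set" where
  "end_positions x = {(i + length x) mod length w | i. x = window i (length x)}"

lemma end_positions_append: "end_positions (r @ p) \<subseteq> end_positions p"
proof
  fix e assume "e \<in> end_positions (r @ p)"
  then obtain i where "e = (i + length (r @ p)) mod length w" "window i (length (r @ p)) = r @ p"
    unfolding end_positions_def by force
  then have "e = (i + length r + length p) mod length w" "p = window (i + length r) (length p)"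
    unfolding window_append_iff by (simp_all only: length_append add.assoc)
  then show "e \<in> end_positions p" unfolding end_positions_def by blast
qed

lemma end_positions_suffix:
  assumes "e \<in> end_positions p" "e \<in> end_positions q" "length p \<le> length q"
  shows "suffix p q"
proof -
  obtain i j where p: "p = window i (length p)" and q: "q = window j (length q)"
    and eq: "[i + length p = j + length q] (mod length w)"
    using assms(1,2) unfolding end_positions_def cong_def by blast
  define d where "d = length q - length p"
  have q': "q = window j d @ window (j + d) (length p)"
    using q[symmetric] assms(3) window_add[of j d "length p"] by (simp add: d_def)
  have "[i + length p = (j + d) + length p] (mod length w)"
    using eq assms(3) by (simp add: d_def)
  then have "[i = j + d] (mod length w)" by (simp add: cong_add_rcancel_nat)
  then have "window (j + d) (length p) = p" using p window_cong[of i "j + d" "length p"] by simp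
  then show ?thesis unfolding suffix_def using q' by (intro exI[of _ "window j d"]) argo
qed

lemma end_positions_subset:
  assumes "e \<in> end_positions p" "e \<in> end_positions q" "length p \<le> length q"
  shows "end_positions q \<subseteq> end_positions p"
proof -
  obtain r where "q = r @ p" using end_positions_suffix[OF assms] by (auto simp: suffix_def)
  then show ?thesis by (simp add: end_positions_append)
qed

text \<open>A common end position makes the shorter word a suffix of the longer one, so every
  occurrence of the longer contains one of the shorter with the same end.\<close>

lemma end_positions_laminar:
  "end_positions p \<inter> end_positions q = {} \<or> end_positions p \<subseteq> end_positions q \<or>
   end_positions q \<subseteq> end_positions p"
proof (cases "end_positions p \<inter> end_positions q = {}")
  case False
  then obtain e where e: "e \<in> end_positions p" "e \<in> end_positions q" by blast
  show ?thesis
    using end_positions_subset[OF e] end_positions_subset[OF e(2,1)] nat_le_linear[of "length p" "length q"]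
    by argo
qed simp

text \<open>Minimal forbidden words themselves are left out: they do not occur, so all of them would
  have the empty set of end positions.\<close>

definition proper_prefixes :: "'a list set" where
  "proper_prefixes = {u. \<exists>v. v \<noteq> [] \<and> u @ v \<in> M}"

lemma end_positions_nonempty:
  assumes "p \<in> F" shows "end_positions p \<noteq> {}"
proof -
  obtain i where "p = window i (length p)" using assms factor_iff by blast
  then have "(i + length p) mod length w \<in> end_positions p"
    unfolding end_positions_def by blast
  then show ?thesis by force
qed

lemma proper_prefix_factor:
  assumes "p \<in> proper_prefixes" shows "p \<in> F"
proof -
  obtain v where "v \<noteq> []" "p @ v \<in> M" using assms by (auto simp: proper_prefixes_def)
  then have "p @ butlast v \<in> F" by (simp add: minimal_forbidden_iff butlast_append)
  then show ?thesis by (rule factor_appendD)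
qed

text \<open>If \<open>q = rp\<close> with \<open>r \<noteq> \<epsilon>\<close> ended at the same positions as \<open>p\<close>, then a minimal forbidden
  word \<open>qs\<close> would occur wherever \<open>ps\<close> does.\<close>

lemma end_positions_append_neq:
  assumes "r @ p \<in> proper_prefixes" "r \<noteq> []"
  shows "end_positions (r @ p) \<noteq> end_positions p"
proof
  assume eq: "end_positions (r @ p) = end_positions p"
  obtain s where s: "(r @ p) @ s \<in> M" using assms(1) unfolding proper_prefixes_def by blast
  \<comment> \<open>Minimality enters here: dropping the first letter, which belongs to
    \<open>r\<close>, already gives a factor, and it still ends with \<open>p @ s\<close>.\<close>
  then have "tl r @ p @ s \<in> F" using assms(2) by (simp add: minimal_forbidden_iff)
  then have "p @ s \<in> F" by (rule factor_appendD)
  then obtain i where i: "p @ s = window i (length p + length s)"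
    unfolding factor_iff length_append ..
  have occ: "p = window i (length p)" "s = window (i + length p) (length s)"
    using window_append_iff[of i "length p + length s" p s] i by argo+
  have "(i + length p) mod length w \<in> end_positions p"
    unfolding end_positions_def using occ by blast
  then have "(i + length p) mod length w \<in> end_positions (r @ p)" by (simp only: eq)
  then obtain j where j: "[i + length p = j + length (r @ p)] (mod length w)"
    "r @ p = window j (length (r @ p))"
    unfolding end_positions_def cong_def mem_Collect_eq by (elim exE conjE)
  have "s = window (j + length (r @ p)) (length s)"
    using occ(2) window_cong[OF j(1), of "length s"] by argo
  then have "window j (length (r @ p) + length s) = (r @ p) @ s"
    using window_add[of j "length (r @ p)" "length s"] j(2) by argo
  then have "(r @ p) @ s \<in> F" using window_factor[of j "length (r @ p) + length s"] by argo
  then show False using s minimal_forbidden_iff by blast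
qed

lemma end_positions_eqD:
  assumes "p \<in> proper_prefixes" "q \<in> proper_prefixes"
    and eq: "end_positions p = end_positions q" and "length p \<le> length q"
  shows "p = q"
proof -
  obtain e where e: "e \<in> end_positions p"
    using end_positions_nonempty[OF proper_prefix_factor[OF assms(1)]] by blast
  have "suffix p q" by (rule end_positions_suffix[OF e _ assms(4)]) (use e eq in simp)
  then obtain r where r: "q = r @ p" by (auto simp: suffix_def)
  have "r = []"
  proof (rule ccontr)
    assume "r \<noteq> []"
    then show False using end_positions_append_neq[of r p] assms(2) eq r by simp
  qed
  then show ?thesis using r by simp
qed

lemma inj_end_positions: "inj_on end_positions proper_prefixes"
proof (rule inj_onI)
  fix p q assume *: "p \<in> proper_prefixes" "q \<in> proper_prefixes" "end_positions p = end_positions q"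
  show "p = q"
  proof (cases "length p \<le> length q")
    case True then show ?thesis by (rule end_positions_eqD[OF *])
  next
    case False
    then have "length q \<le> length p" by simp
    from end_positions_eqD[OF *(2,1) *(3)[symmetric] this] show ?thesis by (rule sym)
  qed
qed

lemma proper_prefixes_bound: "finite proper_prefixes" "card proper_prefixes \<le> 2 * length w"
proof -
  have sub: "end_positions ` proper_prefixes \<subseteq> Pow {..<length w}"
    using length_pos by (auto simp: end_positions_def)
  then have "finite (end_positions ` proper_prefixes)" by (rule finite_subset) simp
  then show "finite proper_prefixes" using inj_end_positions by (rule finite_imageD)
  have "card (end_positions ` proper_prefixes) \<le> 2 * card {..<length w}"
  proof (rule card_laminar_le)
    fix X assume X: "X \<in> end_positions ` proper_prefixes"
    then obtain p where "X = end_positions p" "p \<in> proper_prefixes" by (rule imageE)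
    then show "X \<subseteq> {..<length w} \<and> X \<noteq> {}"
      using subsetD[OF sub X] end_positions_nonempty[OF proper_prefix_factor, of p] by simp
  next
    fix X Y assume "X \<in> end_positions ` proper_prefixes" "Y \<in> end_positions ` proper_prefixes"
    then obtain p q where "X = end_positions p" "Y = end_positions q" by blast
    then show "X \<inter> Y = {} \<or> X \<subseteq> Y \<or> Y \<subseteq> X" using end_positions_laminar[of p q] by simp
  qed simp
  then show "card proper_prefixes \<le> 2 * length w"
    by (simp add: card_image inj_end_positions)
qed

lemma states_subset:
  "S \<subseteq> insert [] proper_prefixes \<union> (\<lambda>(p, a). p @ [a]) ` (insert [] proper_prefixes \<times> A)"
proof
  fix u assume "u \<in> S"
  then show "u \<in> insert [] proper_prefixes \<union> (\<lambda>(p, a). p @ [a]) ` (insert [] proper_prefixes \<times> A)"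
  proof (cases rule: state_cases)
    case 1
    then obtain v a where u: "u = v @ [a]" "a \<in> A"
      by (cases u rule: rev_cases) (auto simp: minimal_forbidden_iff)
    then have "v \<in> proper_prefixes" using 1 unfolding proper_prefixes_def by blast
    then show ?thesis using u by (intro UnI2 image_eqI[of _ _ "(v, a)"]) auto
  next
    case (3 v)
    then have "u \<in> proper_prefixes" unfolding proper_prefixes_def by blast
    then show ?thesis by simp
  qed simp
qed

lemma finite_states: "finite S"
  by (rule finite_subset[OF states_subset]) (use proper_prefixes_bound finite_alphabet in simp)

text \<open>The \<open>3\<close> absorbs the root:
  \<open>1 + 2 * length w \<le> 3 * length w\<close>. Each remaining state is one of these prefixes
  extended by a letter.\<close>

lemma card_states_le: "card S \<le> 3 * length w * (1 + card A)"
proof -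
  let ?Q = "insert [] proper_prefixes"
  have "card ?Q \<le> 1 + card proper_prefixes" by (simp add: card_insert_if proper_prefixes_bound)
  then have Q: "finite ?Q" "card ?Q \<le> 3 * length w"
    using proper_prefixes_bound length_pos by (simp, linarith)
  have "card S \<le> card (?Q \<union> (\<lambda>(p, a). p @ [a]) ` (?Q \<times> A))"
    by (rule card_mono[OF _ states_subset]) (use Q finite_alphabet in simp)
  also have "\<dots> \<le> card ?Q + card ((\<lambda>(p, a). p @ [a]) ` (?Q \<times> A))" by (rule card_Un_le)
  also have "card ((\<lambda>(p, a). p @ [a]) ` (?Q \<times> A)) \<le> card ?Q * card A"
    by (metis Q(1) card_cartesian_product card_image_le finite_SigmaI finite_alphabet)
  finally have "card S \<le> card ?Q * (1 + card A)" by simp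
  also have "\<dots> \<le> 3 * length w * (1 + card A)" using Q(2) by (rule mult_le_mono1)
  finally show ?thesis .
qed

subsection \<open>Periods\<close>

text \<open>The sequence has the periods \<open>l\<close> and \<open>length w\<close>, hence also
  their gcd by Bezout. Then \<open>w\<close> is a power of its prefix of that length, and
  primitivity makes the gcd equal to \<open>length w\<close>.\<close>

lemma period_dvd:
  assumes "\<And>i. letter (i + l) = letter i"
  shows "length w dvd l"
proof (cases "l = 0")
  case False
  have mult: "letter (i + k * l) = letter i" for i k
    by (induction k) (use assms in \<open>auto simp: add.assoc[symmetric] add.commute[of l]\<close>)
  define d where "d = gcd l (length w)"
  have d: "0 < d" "d dvd length w" using length_pos by (auto simp: d_def)
  obtain x y where xy: "l * x = length w * y + d" using bezout_nat[OF False] d_def by blast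
  have "letter (i + d) = letter i" for i
  proof -
    have "i + x * l = i + d + y * length w" using xy by (simp add: mult.commute)
    then have "[i + d = i + x * l] (mod length w)" by (simp only: cong_def mod_mult_self1)
    then show ?thesis using mult[of i x] letter_cong[of "i + d" "i + x * l"] by simp
  qed
  then have d_mult: "letter (i + k * d) = letter i" for i k
    by (induction k) (auto simp: add.assoc[symmetric] add.commute[of d])
  obtain k where k: "length w = k * d" using d(2) by (auto simp: dvd_def mult.commute)
  have d_le: "d \<le> length w" using d(2) length_pos by (simp add: dvd_imp_le)
  have "w = word_pow (take d w) k"
  proof (rule nth_equalityI)
    show "length w = length (word_pow (take d w) k)" using d_le k by (simp add: length_word_pow)
    fix i assume i: "i < length w"
    have "w ! i = letter i" using i by (simp add: letter_def)
    also have "\<dots> = letter (i mod d)" using d_mult[of "i mod d" "i div d"] by simp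
    also have "\<dots> = w ! (i mod d)"
      using d(1) d_le less_le_trans[OF mod_less_divisor, of d "length w" i] by (simp add: letter_def)
    finally show "w ! i = word_pow (take d w) k ! i"
      using i k d d_le by (simp add: nth_word_pow)
  qed
  then have "k = 1" using primitive by (auto simp: primitive_word_def)
  then show ?thesis using k d_def by (metis gcd_dvd1 mult_1)
qed simp

lemma window_conjugate: "window i (length w) \<in> circular_word w"
proof -
  define r where "r = i mod length w"
  have r: "r < length w" using length_pos by (simp add: r_def)
  have "window i (length w) = window r (length w)"
    by (rule window_cong) (simp add: r_def cong_def)
  also have "\<dots> = drop r w @ take r w"
  proof (rule nth_equalityI)
    fix j assume "j < length (window r (length w))"
    then show "window r (length w) ! j = (drop r w @ take r w) ! j"
      using r by (auto simp: nth_append letter_def not_less le_mod_geq add.commute)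
  qed (use r in simp)
  finally show ?thesis
    unfolding circular_word_def
    by (intro CollectI exI[of _ "take r w"] exI[of _ "drop r w"]) simp
qed

end

section \<open>A program logic for random access machines\<close>

definition reaches :: "nat \<Rightarrow> instr list \<Rightarrow> nat \<Rightarrow> config \<Rightarrow> config \<Rightarrow> bool" where
  "reaches B P t c c' \<longleftrightarrow> (\<forall>i\<le>t. fits B ((step P ^^ i) c)) \<and> (step P ^^ t) c = c'"

lemma reaches_refl: "fits B c \<Longrightarrow> reaches B P 0 c c"
  by (simp add: reaches_def)

lemma reaches_fits: "reaches B P t c c' \<Longrightarrow> fits B c'"
  by (auto simp: reaches_def)

lemma reaches_trans:
  assumes "reaches B P s c c'" "reaches B P t c' c''"
  shows "reaches B P (s + t) c c''"
proof -
  have split: "(step P ^^ (s + i)) c = (step P ^^ i) c'" for i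
    using assms(1) by (simp add: reaches_def add.commute[of s] funpow_add)
  have "fits B ((step P ^^ i) c)" if "i \<le> s + t" for i
  proof (cases "i \<le> s")
    case False
    then have "fits B ((step P ^^ (s + (i - s))) c)"
      unfolding split using assms(2) that by (simp add: reaches_def)
    then show ?thesis using False by simp
  qed (use assms in \<open>simp add: reaches_def\<close>)
  then show ?thesis using assms split by (simp add: reaches_def)
qed

lemma reaches_step: "fits B c \<Longrightarrow> step P c = c' \<Longrightarrow> fits B c' \<Longrightarrow> reaches B P 1 c c'"
  by (auto simp: reaches_def le_Suc_eq)

text \<open>Code fragments are parametrised by the address at which they are placed, since jumps are
  absolute.\<close>

type_synonym fragment = "nat \<Rightarrow> instr list"
type_synonym assertion = "(nat \<Rightarrow> nat) \<Rightarrow> (nat \<Rightarrow> nat) \<Rightarrow> bool"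

definition block :: "instr list \<Rightarrow> fragment" where
  "block is n = is"

definition seq :: "fragment \<Rightarrow> fragment \<Rightarrow> fragment" (infixr \<open>;;\<close> 60) where
  "(f ;; g) n = f n @ g (n + length (f n))"

definition loop :: "nat \<Rightarrow> fragment \<Rightarrow> fragment" where
  "loop x f n = JumpZero x (n + length (f (n + 1)) + 2) # f (n + 1) @ [Jump n]"

text \<open>Total correctness with a time bound, where \<open>reaches\<close> enforces the word
  bound at every intermediate step. Quantifying over the surrounding code \<open>pre\<close> and
  \<open>post\<close> makes triples relocatable, and control always leaves at the address just
  behind the fragment.\<close>

definition hoare :: "nat \<Rightarrow> assertion \<Rightarrow> fragment \<Rightarrow> nat \<Rightarrow> assertion \<Rightarrow> bool" where
  "hoare B Q f T R \<longleftrightarrow> (\<forall>pre post c.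
     pc c = length pre \<and> fits B c \<and> Q (reg c) (mem c) \<longrightarrow>
     (\<exists>t\<le>T. \<exists>c'. reaches B (pre @ f (length pre) @ post) t c c' \<and>
        pc c' = length pre + length (f (length pre)) \<and> R (reg c') (mem c')))"

lemma hoareE:
  assumes "hoare B Q f T R" "P = pre @ f n @ post" "length pre = n"
    and "pc c = n" "fits B c" "Q (reg c) (mem c)"
  obtains t c' where "t \<le> T" "reaches B P t c c'" "pc c' = n + length (f n)"
    "R (reg c') (mem c')"
  using assms unfolding hoare_def by blast

lemma hoare_conseq:
  assumes "hoare B Q f T R" "\<And>r m. Q' r m \<Longrightarrow> Q r m" "\<And>r m. R r m \<Longrightarrow> R' r m" "T \<le> T'"
  shows "hoare B Q' f T' R'"
  using assms unfolding hoare_def by (meson order.trans)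

section \<open>Verification conditions and proof rules\<close>

fun arith_fits :: "nat \<Rightarrow> arith \<Rightarrow> nat \<Rightarrow> nat \<Rightarrow> bool" where
  "arith_fits B Add x y \<longleftrightarrow> x + y \<le> B"
| "arith_fits B Mul x y \<longleftrightarrow> x * y \<le> B"
| "arith_fits B Sub x y \<longleftrightarrow> True"
| "arith_fits B Div x y \<longleftrightarrow> True"

text \<open>Covers straight-line code only, hence \<open>False\<close> for jumps; all control flow
  comes from \<open>loop\<close>. The bound has to be checked only where a new value may be large:
  constants, sums and products.\<close>

fun wp :: "nat \<Rightarrow> instr list \<Rightarrow> assertion \<Rightarrow> assertion" where
  "wp B [] R r m \<longleftrightarrow> R r m"
| "wp B (Const d n # is) R r m \<longleftrightarrow> n \<le> B \<and> wp B is R (r(d := n)) m"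
| "wp B (Move d s # is) R r m \<longleftrightarrow> wp B is R (r(d := r s)) m"
| "wp B (Arith f d s t # is) R r m \<longleftrightarrow>
     arith_fits B f (r s) (r t) \<and> wp B is R (r(d := arith_val f (r s) (r t))) m"
| "wp B (Load d s # is) R r m \<longleftrightarrow> wp B is R (r(d := m (r s))) m"
| "wp B (Store d s # is) R r m \<longleftrightarrow> wp B is R r (m(r d := r s))"
| "wp B (Jump n # is) R r m \<longleftrightarrow> False"
| "wp B (JumpZero x n # is) R r m \<longleftrightarrow> False"

lemma arith_fits:
  assumes "arith_fits B f x y" "x \<le> B" shows "arith_val f x y \<le> B"
  using assms by (cases f) (auto intro: le_trans[OF div_le_dividend])

lemma wp_reaches:
  assumes "wp B is R (reg c) (mem c)" "fits B c" "pc c = length pre"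
  shows "\<exists>c'. reaches B (pre @ is @ post) (length is) c c' \<and>
    pc c' = length pre + length is \<and> R (reg c') (mem c')"
  using assms
proof (induction "is" arbitrary: c pre)
  case Nil
  then show ?case using reaches_refl by auto
next
  case (Cons i "is")
  let ?P = "pre @ (i # is) @ post"
  have step: "step ?P c = exec_instr i c"
    using Cons.prems(3) by (simp add: step_def halted_def)
  have "fits B (exec_instr i c) \<and> pc (exec_instr i c) = length pre + 1 \<and>
      wp B is R (reg (exec_instr i c)) (mem (exec_instr i c))"
    using Cons.prems by (cases i) (auto simp: fits_def arith_fits)
  moreover obtain c' where "reaches B ((pre @ [i]) @ is @ post) (length is) (exec_instr i c) c'"
    "pc c' = length (pre @ [i]) + length is" "R (reg c') (mem c')"
    using Cons.IH[of "exec_instr i c" "pre @ [i]"] calculation by auto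
  ultimately show ?case
    using reaches_trans[OF reaches_step[OF Cons.prems(2) step], of "length is" c'] by auto
qed

lemma hoare_block:
  assumes "\<And>r m. (\<And>x. r x \<le> B) \<Longrightarrow> (\<And>i. m i \<le> B) \<Longrightarrow> Q r m \<Longrightarrow> wp B is R r m"
    and "length is \<le> T"
  shows "hoare B Q (block is) T R"
  unfolding hoare_def block_def
proof (intro allI impI, elim conjE)
  fix pre post :: "instr list" and c assume *: "pc c = length pre" "fits B c" "Q (reg c) (mem c)"
  then have "wp B is R (reg c) (mem c)" using assms(1) by (simp add: fits_def)
  from wp_reaches[OF this *(2,1)]
  show "\<exists>t\<le>T. \<exists>c'. reaches B (pre @ is @ post) t c c' \<and>
      pc c' = length pre + length is \<and> R (reg c') (mem c')" using assms(2) by blast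
qed

lemma hoare_seq:
  assumes f: "hoare B Q f T R" and g: "hoare B R g T' U"
  shows "hoare B Q (f ;; g) (T + T') U"
  unfolding hoare_def
proof (intro allI impI, elim conjE)
  fix pre post :: "instr list" and c assume c: "pc c = length pre" "fits B c" "Q (reg c) (mem c)"
  let ?n = "length pre"
  let ?f = "f ?n"
  let ?g = "g (?n + length ?f)"
  let ?P = "pre @ (f ;; g) ?n @ post"
  obtain t c' where t: "t \<le> T" "reaches B ?P t c c'" "pc c' = ?n + length ?f" "R (reg c') (mem c')"
    by (rule hoareE[OF f, of ?P pre ?n "?g @ post" c]) (use c in \<open>simp_all add: seq_def\<close>)
  obtain t' c'' where t': "t' \<le> T'" "reaches B ?P t' c' c''"
    "pc c'' = ?n + length ?f + length ?g" "U (reg c'') (mem c'')"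
    by (rule hoareE[OF g, of ?P "pre @ ?f" "?n + length ?f" post c'])
       (use t reaches_fits in \<open>simp_all add: seq_def\<close>)
  show "\<exists>t\<le>T + T'. \<exists>c'. reaches B ?P t c c' \<and> pc c' = ?n + length ((f ;; g) ?n) \<and>
      U (reg c') (mem c')"
    by (intro exI[of _ "t + t'"] exI[of _ c''] conjI reaches_trans[OF t(2) t'(2)])
       (use t t' in \<open>simp_all add: seq_def\<close>)
qed

text \<open>The invariant \<open>I v\<close> holds when \<open>v\<close> iterations remain.\<close>

lemma hoare_loop:
  assumes body: "\<And>v. v < V \<Longrightarrow> hoare B (I (Suc v)) f T (I v)"
    and cond: "\<And>v r m. I v r m \<Longrightarrow> r x = 0 \<longleftrightarrow> v = 0"
  shows "hoare B (I V) (loop x f) (V * (T + 2) + 1) (I 0)"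
  unfolding hoare_def
proof (intro allI impI, elim conjE)
  fix pre post :: "instr list" and c assume c: "pc c = length pre" "fits B c" "I V (reg c) (mem c)"
  let ?n = "length pre"
  let ?f = "f (?n + 1)"
  let ?P = "pre @ loop x f ?n @ post"
  let ?stop = "?n + length (loop x f ?n)"
  have head: "step ?P c = c\<lparr>pc := if reg c x = 0 then ?stop else ?n + 1\<rparr>" if "pc c = ?n" for c
    using that by (simp add: step_def halted_def loop_def nth_append)
  have jump: "step ?P c = c\<lparr>pc := ?n\<rparr>" if "pc c = ?n + 1 + length ?f" for c
    using that by (simp add: step_def halted_def loop_def nth_append)
  have fits_pc: "fits B (c\<lparr>pc := k\<rparr>) = fits B c" for c k by (simp add: fits_def)
  \<comment> \<open>Each round pays for the test and the backward jump besides the body; the final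
    \<open>1\<close> is the failing test.\<close>
  have "\<exists>t\<le>v * (T + 2) + 1. \<exists>c'. reaches B ?P t c c' \<and> pc c' = ?stop \<and> I 0 (reg c') (mem c')"
    if "v \<le> V" "pc c = ?n" "fits B c" "I v (reg c) (mem c)" for v c
    using that
  proof (induction v arbitrary: c)
    case 0
    then have "reaches B ?P 1 c (c\<lparr>pc := ?stop\<rparr>)"
      by (intro reaches_step) (auto simp: fits_pc head cond[OF 0(4)])
    then show ?case using 0 by (intro exI[of _ 1] exI[of _ "c\<lparr>pc := ?stop\<rparr>"]) auto
  next
    case (Suc v)
    let ?c1 = "c\<lparr>pc := ?n + 1\<rparr>"
    have 1: "reaches B ?P 1 c ?c1"
      using Suc.prems cond[OF Suc.prems(4)] by (intro reaches_step) (auto simp: fits_pc head)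
    have hb: "hoare B (I (Suc v)) f T (I v)" using body Suc.prems(1) by simp
    obtain t c2 where 2: "t \<le> T" "reaches B ?P t ?c1 c2" "pc c2 = ?n + 1 + length ?f"
        "I v (reg c2) (mem c2)"
      by (rule hoareE[OF hb, of ?P "pre @ [JumpZero x (?n + length ?f + 2)]"
            "?n + 1" "Jump ?n # post" ?c1])
         (use Suc.prems in \<open>simp_all add: loop_def fits_pc\<close>)
    let ?c3 = "c2\<lparr>pc := ?n\<rparr>"
    have 3: "reaches B ?P 1 c2 ?c3"
      using 2 reaches_fits by (intro reaches_step) (auto simp: fits_pc jump)
    obtain t' c' where 4: "t' \<le> v * (T + 2) + 1" "reaches B ?P t' ?c3 c'" "pc c' = ?stop"
        "I 0 (reg c') (mem c')"
      using Suc.IH[of ?c3] Suc.prems(1) 2 reaches_fits[OF 2(2)] by (auto simp: fits_pc)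
    show ?case
      by (intro exI[of _ "(1 + t) + (1 + t')"] exI[of _ c'] conjI
            reaches_trans[OF reaches_trans[OF 1 2(2)] reaches_trans[OF 3 4(2)]])
         (use 2 4 in simp_all)
  qed
  then show "\<exists>t\<le>V * (T + 2) + 1. \<exists>c'. reaches B ?P t c c' \<and> pc c' = ?stop \<and> I 0 (reg c') (mem c')"
    using c by blast
qed

text \<open>A halted configuration is a fixed point of \<open>step\<close>, so a run that stops
  early can be padded to exactly \<open>t\<close> steps.\<close>

lemma hoare_computes_within:
  assumes h: "hoare B (\<lambda>r m. r = reg (initial_config xs) \<and> m = mem (initial_config xs)) f T
      (\<lambda>r m. r 1 = length ys \<and> (\<forall>i < length ys. m (r 0 + i) = ys ! i))"
    and fits: "fits B (initial_config xs)" and "T \<le> t"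
  shows "computes_within (f 0) B xs t ys"
proof -
  obtain s c where c: "s \<le> T" "reaches B (f 0) s (initial_config xs) c" "pc c = 0 + length (f 0)"
    "reg c 1 = length ys \<and> (\<forall>i < length ys. mem c (reg c 0 + i) = ys ! i)"
    by (rule hoareE[OF h, of "f 0" "[]" 0 "[]" "initial_config xs"])
       (use fits in \<open>simp_all add: initial_config_def\<close>)
  have halted: "halted (f 0) c" using c(3) by (simp add: halted_def)
  then have "step (f 0) c = c" by (simp add: step_def)
  then have "(step (f 0) ^^ k) c = c" for k by (induction k) auto
  then have "reaches B (f 0) (t - s) c c"
    using reaches_fits[OF c(2)] by (simp add: reaches_def)
  from reaches_trans[OF c(2) this] have "reaches B (f 0) t (initial_config xs) c"
    using assms(3) c(1) by simp
  then show ?thesis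
    using halted c(4) by (simp add: computes_within_def reaches_def has_output_def)
qed

section \<open>The automaton of the factors\<close>

locale coded_circular = primitive_circular A w for A :: "'a set" and w :: "'a list" +
  fixes code :: "'a \<Rightarrow> nat"
  assumes bij_code: "bij_betw code A {..<card A}"
begin

definition decode :: "nat \<Rightarrow> 'a" where "decode = inv_into A code"

lemma code_less: "a \<in> A \<Longrightarrow> code a < card A"
  using bij_code by (auto simp: bij_betw_def)

lemma code_decode: "c < card A \<Longrightarrow> code (decode c) = c"
  using bij_code by (simp add: decode_def bij_betw_inv_into_right)

lemma decode_code: "a \<in> A \<Longrightarrow> decode (code a) = a"
  using bij_code by (simp add: decode_def bij_betw_inv_into_left)

lemma decode_in: "c < card A \<Longrightarrow> decode c \<in> A"
  using bij_code by (metis bij_betw_def decode_def inv_into_into lessThan_iff)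

definition \<delta> :: "'a list \<Rightarrow> 'a \<Rightarrow> 'a list" where "\<delta> u a = longest (u @ [a])"

text \<open>The choice depends on the state alone, which makes the sequence of states eventually
  periodic. Taking the least code matches a scan through a row of the table.\<close>

definition next_code :: "'a list \<Rightarrow> nat" where
  "next_code u = (LEAST c. c < card A \<and> \<delta> u (decode c) \<notin> M)"

definition next_letter :: "'a list \<Rightarrow> 'a" where "next_letter u = decode (next_code u)"

primrec walk :: "nat \<Rightarrow> 'a list" where
  "walk 0 = []"
| "walk (Suc t) = walk t @ [next_letter (longest (walk t))]"

definition place :: "nat \<Rightarrow> 'a list" where "place t = longest (walk t)"

definition out :: "nat \<Rightarrow> 'a" where "out t = next_letter (place t)"

lemma \<delta>_longest: "\<delta> (longest x) a = longest (x @ [a])"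
  by (simp add: \<delta>_def longest_snoc)

lemma next_code_props:
  assumes "x \<in> F"
  shows "next_code (longest x) < card A" "\<delta> (longest x) (next_letter (longest x)) \<notin> M"
    and "c < next_code (longest x) \<Longrightarrow> \<delta> (longest x) (decode c) \<in> M"
proof -
  obtain a where a: "a \<in> A" "x @ [a] \<in> F" using factor_extend[OF assms] .
  then have "\<delta> (longest x) a \<notin> M" using snoc_factor_iff[OF assms] by (simp add: \<delta>_longest)
  then have *: "code a < card A \<and> \<delta> (longest x) (decode (code a)) \<notin> M"
    using a by (simp add: code_less decode_code)
  from LeastI[of "\<lambda>c. c < card A \<and> \<delta> (longest x) (decode c) \<notin> M", OF *]
  show 1: "next_code (longest x) < card A" "\<delta> (longest x) (next_letter (longest x)) \<notin> M"
    by (simp_all add: next_code_def next_letter_def)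
  show "\<delta> (longest x) (decode c) \<in> M" if "c < next_code (longest x)"
    using not_less_Least[OF that[unfolded next_code_def]] that 1(1) by auto
qed

lemma walk_factor: "walk t \<in> F"
proof (induction t)
  case (Suc t)
  then show ?case
    using snoc_factor_iff[OF Suc] next_code_props[OF Suc]
    by (simp add: \<delta>_longest next_letter_def decode_in)
qed (simp add: Nil_factor)

lemma place_state: "place t \<in> S"
  by (simp add: place_def longest_state)

lemma place_0: "place 0 = []"
  by (simp add: place_def)

lemma place_Suc: "place (Suc t) = \<delta> (place t) (next_letter (place t))"
  by (simp add: place_def \<delta>_longest)

lemma code_out: "code (out t) = next_code (place t)"
  using next_code_props(1)[OF walk_factor] by (simp add: out_def next_letter_def place_def code_decode)

lemma place_shift: "place s = place t \<Longrightarrow> place (s + j) = place (t + j)"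
  by (induction j) (simp_all add: place_Suc)

lemma walk_add: "walk (s + m) = walk s @ map out [s..<s + m]"
  by (induction m) (simp_all add: out_def place_def)

subsection \<open>The cycle of the walk\<close>

text \<open>Among the places \<open>0\<close> to \<open>card S\<close> two coincide, and determinism
  carries the repetition forward to \<open>card S\<close>. This is why \<open>card S\<close> steps
  suffice to get onto the cycle.\<close>

lemma place_returns: "\<exists>l. 0 < l \<and> l \<le> card S \<and> place (card S + l) = place (card S)"
proof -
  have "\<not> inj_on place {..card S}"
  proof
    assume "inj_on place {..card S}"
    then have "card {..card S} \<le> card S"
      by (rule card_inj_on_le) (use place_state finite_states in auto)
    then show False by simp
  qed
  then obtain i j where ij: "i < j" "j \<le> card S" "place i = place j"
    unfolding inj_on_def by (metis atMost_iff linorder_neqE_nat)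
  then have "place (card S + (j - i)) = place (card S)"
    using place_shift[of i j "card S - i"] by (simp add: add.commute)
  then show ?thesis using ij by (intro exI[of _ "j - i"]) auto
qed

definition cycle_length :: nat where
  "cycle_length = (LEAST l. 0 < l \<and> place (card S + l) = place (card S))"

lemma cycle_length_props:
  "0 < cycle_length" "place (card S + cycle_length) = place (card S)"
  using place_returns LeastI_ex[of "\<lambda>l. 0 < l \<and> place (card S + l) = place (card S)"]
  unfolding cycle_length_def by blast+

lemma cycle_length_le: "0 < l \<Longrightarrow> place (card S + l) = place (card S) \<Longrightarrow> cycle_length \<le> l"
  unfolding cycle_length_def by (rule Least_le) simp

lemma cycle_length_le_card: "cycle_length \<le> card S"
  using place_returns cycle_length_le le_trans by blast

text \<open>Every stretch of the walk is a factor. The offset \<open>i\<close> may depend on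
  \<open>m\<close>.\<close>

lemma out_window: "\<exists>i. \<forall>j<m. out (t + j) = letter (i + j)"
proof -
  have "map out [t..<t + m] \<in> F"
    using walk_factor[of "t + m"] unfolding walk_add by (rule factor_appendD)
  then obtain i where i: "map out [t..<t + m] = window i m" by (auto simp: factor_iff)
  have "out (t + j) = letter (i + j)" if "j < m" for j
    using arg_cong[OF i, of "\<lambda>x. x ! j"] that by simp
  then show ?thesis by blast
qed

text \<open>The cycle length is a period of the letters read, hence a multiple of \<open>|w|\<close> by primitivity.
  Conversely the states have bounded length, so far enough into the cycle a state depends only on
  letters read within the cycle, which repeat after \<open>|w|\<close> steps.\<close>

lemma cycle_length_eq: "cycle_length = length w"
proof -
  define N where "N = card S"
  define l where "l = cycle_length"
  define n where "n = length w"
  \<comment> \<open>A multiple of \<open>l\<close>, so that \<open>D\<close> further steps on the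
    cycle change nothing, and at least the length of any state.\<close>
  define D where "D = l * Max (length ` S)"
  have l: "0 < l" "place (N + l) = place N" using cycle_length_props by (simp_all add: l_def N_def)
  have n: "0 < n" using length_pos by (simp add: n_def)
  have per: "place (N + j + l) = place (N + j)" for j
    using place_shift[OF l(2), of j] by (simp add: add.commute add.left_commute)
  have per_mult: "place (N + j + k * l) = place (N + j)" for j k
  proof (induction k)
    case (Suc k)
    then show ?case using per[of "j + k * l"] by (simp add: add_ac)
  qed simp
  have short: "length (place t) \<le> D" for t
  proof -
    have "length (place t) \<le> Max (length ` S)" using place_state finite_states by simp
    also have "\<dots> \<le> D" using l(1) by (simp add: D_def)
    finally show ?thesis .
  qed
  \<comment> \<open>One offset must serve both comparisons: shifting the first \<open>n\<close>
    letters by \<open>l\<close> and shifting the first \<open>D\<close> letters by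
    \<open>n\<close>.\<close>
  obtain i where i: "\<And>j. j < n + l + D \<Longrightarrow> out (N + j) = letter (i + j)"
    using out_window[of "n + l + D" N] by blast
  have "letter (x + l) = letter x" for x
  proof -
    \<comment> \<open>Modulo \<open>n\<close>, \<open>i * (n - 1)\<close> is the negative of
      \<open>i\<close>; so \<open>j\<close> is the place in the stretch where position
      \<open>x\<close> of the circle is read.\<close>
    define j where "j = (x + i * (n - 1)) mod n"
    have "i + (x + i * (n - 1)) = x + i * n" using n by (cases n) (auto simp: algebra_simps)
    then have "[i + j = x] (mod n)"
      unfolding cong_def j_def by (metis mod_add_right_eq mod_mult_self1)
    then have "[i + j + l = x + l] (mod n)" "[i + j = x] (mod n)" by (auto intro: cong_add)
    then have "letter (i + j + l) = letter (x + l)" "letter (i + j) = letter x"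
      unfolding n_def by (auto intro: letter_cong)
    moreover have "j < n" using n by (simp add: j_def)
    ultimately show ?thesis using i[of j] i[of "j + l"] per[of j] by (simp add: out_def add.assoc)
  qed
  then have "n dvd l" unfolding n_def by (rule period_dvd)
  have place_eq: "place (s + D) = longest (map out [s..<s + D])" for s
    using short[of "s + D"] unfolding place_def walk_add
    by (intro longest_suffix_in_append) simp
  have "out (N + n + j) = out (N + j)" if "j < D" for j
  proof -
    have "i + (n + j) = i + j + n" by simp
    then have "[i + (n + j) = i + j] (mod n)" by (simp only: cong_def mod_add_self2)
    then show ?thesis
      using i[of "n + j"] i[of j] that letter_cong[of "i + (n + j)" "i + j"]
      by (simp add: n_def add.assoc)
  qed
  then have "map out [N + n..<N + n + D] = map out [N..<N + D]"
    by (intro nth_equalityI) auto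
  then have "place (N + n + D) = place (N + D)" by (simp add: place_eq)
  then have "place (N + n) = place N"
    using per_mult[of n "Max (length ` S)"] per_mult[of 0 "Max (length ` S)"]
    by (simp add: D_def mult.commute)
  then have "l \<le> n" using n cycle_length_le by (simp add: l_def N_def)
  then show ?thesis using \<open>n dvd l\<close> l(1) unfolding l_def n_def by (simp add: dvd_imp_le le_antisym)
qed

lemma cycle_word: "map out [card S..<card S + cycle_length] \<in> circular_word w"
proof -
  obtain i where "\<forall>j<length w. out (card S + j) = letter (i + j)"
    using out_window[of "length w" "card S"] by blast
  then have "map out [card S..<card S + cycle_length] = window i (length w)"
    by (intro nth_equalityI) (auto simp: cycle_length_eq)
  then show ?thesis using window_conjugate by simp
qed

end

section \<open>The program\<close>

text \<open>Registers 2 to 8 hold the number of states, the root, 1, the length of a record, the address of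
  the queue, the number of letters, and 2. A virtual state, numbered one beyond the last state and
  mapped to the root by each letter, serves as the failure state of the root. Its record follows
  the input, and the queue of pairs of a state and its failure state follows that record.\<close>

definition initialise :: "nat \<Rightarrow> fragment" where
  "initialise k = block [Const 14 0, Load 2 14, Const 4 1, Load 3 4, Const 5 (1 + k), Const 7 k, Const 8 2,
     Arith Add 6 2 4, Arith Mul 6 6 5, Arith Add 6 6 8,
     Arith Mul 11 2 5, Arith Add 11 11 8, Move 13 7, Arith Add 14 3 4]"

definition virtual_state :: fragment where
  "virtual_state = loop 13 (block [Arith Add 11 11 4, Store 11 14, Arith Sub 13 13 4])"

definition enqueue_root :: fragment where
  "enqueue_root = block [Store 6 3, Arith Add 10 6 4, Store 10 2, Arith Add 10 10 4, Move 9 6,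
     Arith Sub 16 10 9]"

definition dequeue :: fragment where
  "dequeue = block [Load 11 9, Arith Mul 11 11 5, Arith Add 11 11 8, Arith Add 9 9 4,
     Load 12 9, Arith Mul 12 12 5, Arith Add 12 12 8, Arith Add 9 9 4, Move 13 7]"

text \<open>Branch-free: the pair for a child is always written behind the queue, but the queue grows
  only if there is a child.\<close>

definition process_letter :: fragment where
  "process_letter = block [Arith Add 11 11 4, Arith Add 12 12 4, Load 14 11, Load 15 12,
     Arith Sub 16 4 14, Arith Mul 17 16 15, Arith Add 17 17 14, Store 11 17,
     Arith Sub 14 14 4, Store 10 14, Arith Add 18 10 4, Arith Sub 15 15 4, Store 18 15,
     Arith Sub 16 4 16, Arith Add 16 16 16, Arith Add 10 10 16, Arith Sub 13 13 4]"

definition breadth_first :: fragment where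
  "breadth_first = loop 16 (dequeue ;; loop 13 process_letter ;; block [Arith Sub 16 10 9])"

definition start_walk :: fragment where
  "start_walk = block [Move 10 3, Move 9 2]"

definition walk_step :: fragment where
  "walk_step = block [Arith Mul 11 10 5, Arith Add 11 11 8, Const 13 0, Const 14 1] ;;
     loop 14 (block [Arith Add 11 11 4, Arith Add 13 13 4, Load 12 11, Arith Sub 12 12 4,
       Arith Mul 14 12 5, Arith Add 14 14 8, Load 14 14]) ;;
     block [Move 10 12]"

definition settle :: fragment where
  "settle = loop 9 (walk_step ;; block [Arith Sub 9 9 4])"

definition start_output :: fragment where
  "start_output = block [Move 15 10, Move 0 6, Const 1 0, Const 9 1]"

text \<open>The sum of the two truncated differences vanishes iff the walk is back at its start.\<close>

definition output_cycle :: fragment where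
  "output_cycle = loop 9 (walk_step ;; block [Arith Sub 16 13 4, Arith Add 17 0 1, Store 17 16,
     Arith Add 1 1 4, Arith Sub 9 10 15, Arith Sub 17 15 10, Arith Add 9 9 17])"

definition reconstruct :: "nat \<Rightarrow> fragment" where
  "reconstruct k = initialise k ;; virtual_state ;; enqueue_root ;; breadth_first ;;
     start_walk ;; settle ;; start_output ;; output_cycle"

section \<open>Correctness\<close>

locale encoded_trie = coded_circular A w code
  for A :: "'a set" and w :: "'a list" and code :: "'a \<Rightarrow> nat" +
  fixes num :: "'a list \<Rightarrow> nat" and xs :: "nat list" and B :: nat
  assumes bij_num: "bij_betw num S {..<card S}"
    and length_xs: "length xs = 2 + card S * (1 + card A)"
    and xs_0: "xs ! 0 = card S" and xs_1: "xs ! 1 = num []"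
    and xs_flag: "\<And>u. u \<in> S \<Longrightarrow> xs ! (2 + num u * (1 + card A)) = (if u \<in> M then 1 else 0)"
    and xs_cell: "\<And>u a. u \<in> S \<Longrightarrow> a \<in> A \<Longrightarrow> xs ! (2 + num u * (1 + card A) + 1 + code a) =
      (if u @ [a] \<in> S then num (u @ [a]) + 1 else 0)"
    and bound: "4 * length xs \<le> B"
begin

abbreviation "N \<equiv> card S"
abbreviation "k \<equiv> card A"

definition addr :: "nat \<Rightarrow> nat" where "addr q = 2 + q * (1 + k)"
definition Q :: nat where "Q = 2 + (N + 1) * (1 + k)"

subsection \<open>Addresses\<close>

lemma num_less: "u \<in> S \<Longrightarrow> num u < N"
  using bij_num by (auto simp: bij_betw_def)

lemma num_inj: "u \<in> S \<Longrightarrow> v \<in> S \<Longrightarrow> num u = num v \<longleftrightarrow> u = v"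
  using bij_num by (auto simp: bij_betw_def inj_on_def)

lemma card_pos: "0 < N"
  using Nil_state finite_states by (auto simp: card_gt_0_iff)

lemma addr_less: "q < p \<Longrightarrow> addr q + k < addr p"
proof -
  assume "q < p"
  then have "Suc q * (1 + k) \<le> p * (1 + k)" by (intro mult_le_mono1) simp
  then show ?thesis by (simp add: addr_def)
qed

lemma addr_mono: "q \<le> p \<Longrightarrow> addr q \<le> addr p"
  unfolding addr_def by (intro add_left_mono mult_le_mono1)

lemma Q_eq: "Q = addr N + k + 1"
  by (simp add: Q_def addr_def)

lemma length_xs_addr: "length xs = addr N"
  by (simp add: length_xs addr_def)

lemma addr_N_ge: "N + 2 \<le> addr N" "k + 3 \<le> addr N"
proof -
  show "N + 2 \<le> addr N" by (simp add: addr_def)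
  have "1 * (1 + k) \<le> N * (1 + k)" using card_pos by (intro mult_le_mono1) simp
  then show "k + 3 \<le> addr N" by (simp add: addr_def)
qed

text \<open>Origin of the \<open>4\<close>: the input is one length, the virtual record fits into a
  second, and the queue of pairs into two more.\<close>

lemma bound': "Q + 2 * N + 1 \<le> B" "4 \<le> B" "k + 3 \<le> B"
  using bound addr_N_ge card_pos unfolding Q_eq length_xs_addr by linarith+

lemma addr_inj: "c \<le> k \<Longrightarrow> c' \<le> k \<Longrightarrow> addr q + c = addr q' + c' \<longleftrightarrow> q = q' \<and> c = c'"
  using addr_less[of q q'] addr_less[of q' q] by (cases q q' rule: linorder_cases) auto

lemma code_inj: "a \<in> A \<Longrightarrow> b \<in> A \<Longrightarrow> code a = code b \<longleftrightarrow> a = b"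
  by (metis decode_code)

subsection \<open>Breadth-first search\<close>

text \<open>\<open>tl\<close> restricts the search to proper suffixes. The root has none; the
  virtual state \<open>N\<close> answers every letter with the root, in accordance with
  \<open>longest (tl [a]) = []\<close>.\<close>

definition failure :: "'a list \<Rightarrow> nat" where
  "failure u = (if u = [] then N else num (longest (tl u)))"

text \<open>\<open>us\<close> lists the states enqueued so far. The first \<open>h\<close> of them are processed, and so are
  the first \<open>c\<close> letters of the next one.\<close>

definition processed :: "'a list list \<Rightarrow> nat \<Rightarrow> nat \<Rightarrow> 'a list \<Rightarrow> 'a \<Rightarrow> bool" where
  "processed us h c u a \<longleftrightarrow> u \<in> set (take h us) \<or> h < length us \<and> u = us ! h \<and> code a < c"

definition queue_ok :: "'a list list \<Rightarrow> nat \<Rightarrow> nat \<Rightarrow> bool" where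
  "queue_ok us h c \<longleftrightarrow> distinct us \<and> set us \<subseteq> S \<and> us \<noteq> [] \<and> us ! 0 = [] \<and> h \<le> length us \<and>
     sorted (map length us) \<and>
     (\<forall>u a. u @ [a] \<in> S \<longrightarrow> (u @ [a] \<in> set us \<longleftrightarrow> processed us h c u a))"

definition mem_ok :: "'a list list \<Rightarrow> nat \<Rightarrow> nat \<Rightarrow> (nat \<Rightarrow> nat) \<Rightarrow> bool" where
  "mem_ok us h c m \<longleftrightarrow>
     (\<forall>u\<in>S. m (addr (num u)) = (if u \<in> M then 1 else 0)) \<and>
     (\<forall>u\<in>S. \<forall>a\<in>A. m (addr (num u) + Suc (code a)) =
        (if processed us h c u a then Suc (num (\<delta> u a))
         else if u @ [a] \<in> S then Suc (num (u @ [a])) else 0)) \<and>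
     (\<forall>c<k. m (addr N + Suc c) = Suc (num [])) \<and>
     (\<forall>i<length us. m (Q + 2 * i) = num (us ! i) \<and> m (Suc (Q + 2 * i)) = failure (us ! i))"

lemma state_snocD: "u @ [a] \<in> S \<Longrightarrow> u \<in> S" "u @ [a] \<in> S \<Longrightarrow> a \<in> A"
  using state_appendD[of u "[a]"] state_lists[of "u @ [a]"] by auto

lemma queue_length_le: "queue_ok us h c \<Longrightarrow> length us \<le> N"
  using card_mono[OF finite_states, of "set us"] by (simp add: queue_ok_def distinct_card)

text \<open>By induction the parent of \<open>v\<close> is finished, so \<open>v\<close> has been
  enqueued; as the queue is sorted by length, it stands before position \<open>h\<close>.\<close>

lemma shorter_processed:
  assumes "queue_ok us h c" "h < length us" "v \<in> S" "length v < length (us ! h)"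
  shows "v \<in> set (take h us)"
  using assms(3,4)
proof (induction v rule: rev_induct)
  case Nil
  then have "0 < h" using assms(1) by (cases h) (auto simp: queue_ok_def)
  then have "take h us ! 0 = []" "0 < length (take h us)"
    using assms(1,2) by (auto simp: queue_ok_def)
  then show ?case by (metis nth_mem)
next
  case (snoc a v)
  then have "v \<in> set (take h us)" using state_snocD by auto
  then have "v @ [a] \<in> set us"
    using snoc.prems(1) assms(1) by (auto simp: queue_ok_def processed_def)
  then obtain j where j: "j < length us" "us ! j = v @ [a]" by (auto simp: in_set_conv_nth)
  have "j < h"
  proof (rule ccontr)
    assume "\<not> j < h"
    then have "length (us ! h) \<le> length (us ! j)"
      using assms(1) j(1) sorted_nth_mono[of "map length us" h j] by (auto simp: queue_ok_def)
    then show False using snoc.prems(2) j(2) by simp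
  qed
  then show ?case using j by (metis in_set_conv_nth length_take min_less_iff_conj nth_take)
qed

lemma queue_complete:
  assumes "queue_ok us (length us) 0" shows "set us = S"
proof
  show "set us \<subseteq> S" using assms by (simp add: queue_ok_def)
  have "u \<in> set us" if "u \<in> S" for u
    using that
  proof (induction u rule: rev_induct)
    case Nil
    then show ?case using assms unfolding queue_ok_def by (metis length_greater_0_conv nth_mem)
  next
    case (snoc a u)
    then show ?case using assms state_snocD by (auto simp: queue_ok_def processed_def)
  qed
  then show "S \<subseteq> set us" by blast
qed

text \<open>The machine tests whether the queue is empty, whereas the loop rule counts remaining
  iterations; this identifies the two.\<close>

lemma queue_end:
  assumes "queue_ok us h 0" shows "h = length us \<longleftrightarrow> h = N"
proof
  assume "h = length us"
  then show "h = N"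
    using queue_complete[of us] distinct_card[of us] assms by (simp add: queue_ok_def)
next
  assume "h = N"
  then show "h = length us"
    using queue_length_le[OF assms] assms by (simp add: queue_ok_def)
qed

text \<open>Keeps the queue sorted when a child of \<open>us ! h\<close> is appended: every enqueued
  word is the root or a child of a state no later than \<open>us ! h\<close>.\<close>

lemma queue_lengths:
  assumes "queue_ok us h c" "h < length us" "v \<in> set us"
  shows "length v \<le> Suc (length (us ! h))"
proof (cases v rule: rev_cases)
  case (snoc u a)
  then have "processed us h c u a" using assms by (auto simp: queue_ok_def)
  then consider "u = us ! h" | i where "i < h" "u = us ! i"
    using assms(2) by (auto simp: processed_def in_set_conv_nth)
  then have "length u \<le> length (us ! h)"
  proof cases
    case 2
    then show ?thesis
      using assms sorted_nth_mono[of "map length us" i h] by (auto simp: queue_ok_def)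
  qed simp
  then show ?thesis using snoc by simp
qed simp

lemma processed_next:
  "a \<in> A \<Longrightarrow> h < length us \<Longrightarrow> processed us h k u a \<longleftrightarrow> processed us (Suc h) 0 u a"
  by (auto simp: processed_def code_less take_Suc_conv_app_nth)

lemma queue_ok_next: "queue_ok us h k \<Longrightarrow> h < length us \<Longrightarrow> queue_ok us (Suc h) 0"
  by (auto simp: queue_ok_def processed_next[symmetric] state_snocD)

lemma mem_ok_next: "mem_ok us h k m \<Longrightarrow> h < length us \<Longrightarrow> mem_ok us (Suc h) 0 m"
  by (simp add: mem_ok_def processed_next[symmetric])

lemma \<delta>_state: "u @ [a] \<in> S \<Longrightarrow> \<delta> u a = u @ [a]"
  by (simp add: \<delta>_def longest_suffix_in_id)

lemma \<delta>_no_state: "u @ [a] \<notin> S \<Longrightarrow> \<delta> u a = longest (tl (u @ [a]))"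
  by (cases u) (auto simp: \<delta>_def)

lemma queue_step:
  assumes ok: "queue_ok us h c" and h: "h < length us" and c: "c < k"
    and us': "us' = us @ (if us ! h @ [decode c] \<in> S then [us ! h @ [decode c]] else [])"
  shows "queue_ok us' h (Suc c)"
    and "\<And>v b. b \<in> A \<Longrightarrow> processed us' h (Suc c) v b \<longleftrightarrow>
          processed us h c v b \<or> v = us ! h \<and> b = decode c"
proof -
  let ?u = "us ! h" and ?a = "decode c"
  have a: "?a \<in> A" "code ?a = c" using c by (simp_all add: decode_in code_decode)
  show step: "processed us' h (Suc c) v b \<longleftrightarrow> processed us h c v b \<or> v = ?u \<and> b = ?a"
    if "b \<in> A" for v b
    using h a code_inj[OF that a(1)] unfolding processed_def us' by (auto simp: nth_append less_Suc_eq)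
  have new: "\<not> processed us h c ?u ?a"
    using ok h a by (auto simp: processed_def queue_ok_def in_set_conv_nth nth_eq_iff_index_eq)
  show "queue_ok us' h (Suc c)"
  proof (cases "?u @ [?a] \<in> S")
    case True
    then have us'': "us' = us @ [?u @ [?a]]" using us' by simp
    have "?u @ [?a] \<notin> set us" using True ok new by (auto simp: queue_ok_def)
    moreover have "sorted (map length us')"
      using ok queue_lengths[OF ok h] by (auto simp: us'' queue_ok_def sorted_append)
    moreover have "v @ [b] \<in> set us' \<longleftrightarrow> processed us' h (Suc c) v b" if "v @ [b] \<in> S" for v b
      using that ok step[of b v] state_snocD[OF that] by (auto simp: us'' queue_ok_def)
    ultimately show ?thesis using ok True by (auto simp: queue_ok_def us'' nth_append)
  next
    case False
    then have us'': "us' = us" using us' by simp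
    have "v @ [b] \<in> set us' \<longleftrightarrow> processed us' h (Suc c) v b" if "v @ [b] \<in> S" for v b
      using that False ok step[of b v] state_snocD[OF that] by (auto simp: us'' queue_ok_def)
    then show ?thesis using ok by (auto simp: queue_ok_def us'')
  qed
qed

text \<open>Makes it safe to complete the table in place. The cell of the current state is still a
  plain trie edge, while the failure state is strictly shorter, so its row already holds final
  transitions.\<close>

lemma table_reads:
  assumes q: "queue_ok us h c" and m: "mem_ok us h c m" and h: "h < length us" and c: "c < k"
  shows "m (addr (num (us ! h)) + Suc c) =
      (if us ! h @ [decode c] \<in> S then Suc (num (us ! h @ [decode c])) else 0)"
    and "m (addr (failure (us ! h)) + Suc c) = Suc (num (longest (tl (us ! h @ [decode c]))))"
proof -
  let ?u = "us ! h" and ?a = "decode c"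
  have a: "?a \<in> A" "code ?a = c" using c by (simp_all add: decode_in code_decode)
  have u: "?u \<in> S" using q h by (auto simp: queue_ok_def)
  have "\<not> processed us h c ?u ?a"
    using q h a by (auto simp: processed_def queue_ok_def in_set_conv_nth nth_eq_iff_index_eq)
  then show "m (addr (num ?u) + Suc c) = (if ?u @ [?a] \<in> S then Suc (num (?u @ [?a])) else 0)"
    using m u a unfolding mem_ok_def by metis
  show "m (addr (failure ?u) + Suc c) = Suc (num (longest (tl (?u @ [?a]))))"
  proof (cases "?u = []")
    case True
    then show ?thesis using m c by (simp add: mem_ok_def failure_def)
  next
    case False
    let ?f = "longest (tl ?u)"
    have f: "?f \<in> S" by (rule longest_state)
    have "length ?f \<le> length (tl ?u)" using suffix_length_le suffix_longest_suffix_in by blast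
    then have "length ?f < length ?u" using False by (cases ?u) auto
    then have "processed us h c ?f ?a"
      using shorter_processed[OF q h f] by (simp add: processed_def)
    then have "m (addr (num ?f) + Suc (code ?a)) = Suc (num (\<delta> ?f ?a))"
      using m f a(1) by (simp add: mem_ok_def)
    then show ?thesis using False a(2) by (simp add: failure_def \<delta>_longest)
  qed
qed

lemma cell_less_Q: "q \<le> N \<Longrightarrow> c \<le> k \<Longrightarrow> addr q + c < Q"
  using addr_mono[of q N] by (simp add: Q_eq)

lemma mem_step:
  assumes q: "queue_ok us h c" and m: "mem_ok us h c m" and h: "h < length us" and c: "c < k"
    and us': "us' = us @ (if us ! h @ [decode c] \<in> S then [us ! h @ [decode c]] else [])"
    and t: "t = m (addr (num (us ! h)) + Suc c)" and d: "d = m (addr (failure (us ! h)) + Suc c)"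
    and m': "m' = m(addr (num (us ! h)) + Suc c := (1 - t) * d + t,
                    Q + 2 * length us := t - 1, Suc (Q + 2 * length us) := d - 1)"
  shows "mem_ok us' h (Suc c) m'"
proof -
  let ?u = "us ! h" and ?a = "decode c"
  note step = queue_step(2)[OF q h c us']
  have a: "?a \<in> A" "code ?a = c" using c by (simp_all add: decode_in code_decode)
  have u: "?u \<in> S" using q h by (auto simp: queue_ok_def)
  note t = t[unfolded table_reads(1)[OF q m h c]] and d = d[unfolded table_reads(2)[OF q m h c]]
  have low: "m' (addr q + c') = (if addr q + c' = addr (num ?u) + Suc c then (1 - t) * d + t
      else m (addr q + c'))" if "q \<le> N" "c' \<le> k" for q c'
    using cell_less_Q[OF that] by (auto simp: m')
  \<comment> \<open>With truncated subtraction the formula is a selection: \<open>d\<close> if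
    \<open>t = 0\<close>, and \<open>t\<close> otherwise.\<close>
  have val: "(1 - t) * d + t = Suc (num (\<delta> ?u ?a))"
    using \<delta>_state[of ?u ?a] \<delta>_no_state[of ?u ?a] by (simp add: t d)
  have flags: "m' (addr (num v)) = (if v \<in> M then 1 else 0)" if "v \<in> S" for v
    using low[of "num v" 0] num_less[OF that] addr_inj[of 0 "Suc c" "num v" "num ?u"] c m that
    by (auto simp: mem_ok_def)
  have cells: "m' (addr (num v) + Suc (code b)) =
      (if processed us' h (Suc c) v b then Suc (num (\<delta> v b))
       else if v @ [b] \<in> S then Suc (num (v @ [b])) else 0)" if "v \<in> S" "b \<in> A" for v b
  proof -
    have "addr (num v) + Suc (code b) = addr (num ?u) + Suc c \<longleftrightarrow> v = ?u \<and> b = ?a"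
      using addr_inj[of "Suc (code b)" "Suc c" "num v" "num ?u"] code_less[OF that(2)] c
        num_inj[OF that(1) u] code_inj[OF that(2) a(1)] a(2) by auto
    then show ?thesis
      using low[of "num v" "Suc (code b)"] num_less[OF that(1)] code_less[OF that(2)] val
        step[OF that(2), of v] m that by (auto simp: mem_ok_def)
  qed
  have virt: "m' (addr N + Suc c') = Suc (num [])" if "c' < k" for c'
    using low[of N "Suc c'"] addr_inj[of "Suc c'" "Suc c" N "num ?u"] num_less[OF u] that c m
    by (simp add: mem_ok_def)
  have "m' (Q + 2 * i) = num (us' ! i) \<and> m' (Suc (Q + 2 * i)) = failure (us' ! i)"
    if "i < length us'" for i
  proof (cases "i < length us")
    case True
    have "addr (num ?u) + Suc c < Q" using cell_less_Q[of "num ?u" "Suc c"] num_less[OF u] c by simp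
    then have "m' (Q + 2 * i) = m (Q + 2 * i)" "m' (Suc (Q + 2 * i)) = m (Suc (Q + 2 * i))"
      using True by (auto simp: m')
    then show ?thesis using m True by (simp add: mem_ok_def us' nth_append)
  next
    case False
    then have i: "i = length us" "?u @ [?a] \<in> S" using that by (auto simp: us' split: if_splits)
    then show ?thesis by (simp add: m' us' t d failure_def)
  qed
  then show ?thesis using flags cells virt unfolding mem_ok_def by blast
qed

subsection \<open>Execution\<close>

definition consts_ok :: "(nat \<Rightarrow> nat) \<Rightarrow> bool" where
  "consts_ok r \<longleftrightarrow> r 2 = N \<and> r 3 = num [] \<and> r 4 = 1 \<and> r 5 = 1 + k \<and> r 6 = Q \<and> r 7 = k \<and> r 8 = 2"

lemma consts_ok_upd:
  "x \<notin> {2..8} \<Longrightarrow> consts_ok (r(x := v)) = consts_ok r"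
  by (auto simp: consts_ok_def)

section \<open>The input as initial memory\<close>

lemma initial_mem: "mem (initial_config xs) i = (if i < addr N then xs ! i else 0)"
  by (simp add: initial_config_def length_xs_addr)

lemma initial_flag: "u \<in> S \<Longrightarrow> mem (initial_config xs) (addr (num u)) = (if u \<in> M then 1 else 0)"
  using xs_flag[of u] addr_less[OF num_less, of u] by (simp add: initial_mem addr_def)

lemma initial_cell:
  assumes "u \<in> S" "a \<in> A"
  shows "mem (initial_config xs) (addr (num u) + Suc (code a)) =
    (if u @ [a] \<in> S then Suc (num (u @ [a])) else 0)"
  using xs_cell[OF assms] addr_less[OF num_less[OF assms(1)]] code_less[OF assms(2)]
  by (simp add: initial_mem addr_def)

text \<open>Division with remainder shows that every input cell is in the header or in the record of
  some state, so the encoding determines it. Stored targets are numbers plus one, hence still at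
  most \<open>N\<close>.\<close>

lemma initial_le: "mem (initial_config xs) i \<le> N"
proof (cases "i < addr N")
  case True
  have *: "mem (initial_config xs) i = xs ! i" using True by (simp add: initial_mem)
  consider "i = 0" | "i = 1" | q c where "i = addr q + c" "q < N" "c \<le> k"
  proof (cases "i < 2")
    case False
    define q c where "q = (i - 2) div (1 + k)" and "c = (i - 2) mod (1 + k)"
    have "q * (1 + k) + c = i - 2" unfolding q_def c_def by (rule div_mult_mod_eq)
    then have "i = addr q + c" using False by (simp add: addr_def)
    moreover have "c \<le> k" unfolding c_def by (metis Suc_eq_plus1_left less_Suc_eq_le mod_less_divisor zero_less_Suc)
    moreover have "q < N"
      using True False unfolding q_def addr_def by (intro less_mult_imp_div_less) simp
    ultimately show ?thesis using that by blast
  qed (use that in linarith)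
  then show ?thesis
  proof cases
    case (3 q c)
    then obtain u where u: "u \<in> S" "q = num u"
      using bij_num by (metis bij_betw_def imageE lessThan_iff)
    show ?thesis
    proof (cases c)
      case 0
      then show ?thesis using 3 u initial_flag[of u] card_pos by auto
    next
      case (Suc c')
      then have "c' < k" using 3 by simp
      then have "mem (initial_config xs) i =
          (if u @ [decode c'] \<in> S then Suc (num (u @ [decode c'])) else 0)"
        using initial_cell[OF u(1) decode_in, of c'] 3 u Suc by (simp add: code_decode)
      then show ?thesis using num_less by (auto simp: Suc_le_eq)
    qed
  qed (use * xs_0 xs_1 num_less[OF Nil_state] in auto)
qed (simp add: initial_mem)

lemma initial_fits: "fits B (initial_config xs)"
proof -
  have "N \<le> B" using bound' by simp
  then have "mem (initial_config xs) i \<le> B" for i using initial_le[of i] by (rule le_trans[rotated])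
  moreover have "reg (initial_config xs) i \<le> B" for i by (simp add: initial_config_def)
  ultimately show ?thesis by (simp add: fits_def)
qed

section \<open>Setting up the virtual state and the queue\<close>

lemma initialise_correct:
  "hoare B (\<lambda>r m. r = reg (initial_config xs) \<and> m = mem (initial_config xs)) (initialise k) 14
    (\<lambda>r m. consts_ok r \<and> r 11 = addr N \<and> r 13 = k \<and> r 14 = Suc (num []) \<and>
      m = mem (initial_config xs))"
proof -
  have "0 < addr N" "1 < addr N" using addr_N_ge by linarith+
  moreover have "Suc (num []) \<le> B" using num_less[OF Nil_state] bound' by linarith
  moreover have "N + 1 \<le> B" "(N + 1) * (1 + k) \<le> B" "(N + 1) * (1 + k) + 2 \<le> B"
    "N * (1 + k) \<le> B" "N * (1 + k) + 2 \<le> B"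
    using bound' by (auto simp: Q_def)
  ultimately show ?thesis
    unfolding initialise_def using bound'
    by (intro hoare_block)
      (auto simp: consts_ok_def initial_mem xs_0 xs_1[simplified] Q_def addr_def)
qed

lemma virtual_state_correct:
  "hoare B (\<lambda>r m. consts_ok r \<and> r 11 = addr N \<and> r 13 = k \<and> r 14 = Suc (num []) \<and>
      m = mem (initial_config xs)) virtual_state (k * 5 + 1)
    (\<lambda>r m. consts_ok r \<and> (\<forall>i < addr N. m i = mem (initial_config xs) i) \<and> m (addr N) = 0 \<and>
      (\<forall>c<k. m (addr N + Suc c) = Suc (num [])))"
proof -
  define I where "I v r m \<longleftrightarrow> v \<le> k \<and> consts_ok r \<and> r 11 = addr N + (k - v) \<and> r 13 = v \<and>
      r 14 = Suc (num []) \<and> (\<forall>i \<le> addr N. m i = mem (initial_config xs) i) \<and>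
      (\<forall>c<k - v. m (addr N + Suc c) = Suc (num []))" for v and r m :: "nat \<Rightarrow> nat"
  have "hoare B (I k) virtual_state (k * (3 + 2) + 1) (I 0)"
    unfolding virtual_state_def
  proof (rule hoare_loop)
    fix v assume "v < k"
    have *: "k - v = Suc (k - Suc v)" using \<open>v < k\<close> by simp
    show "hoare B (I (Suc v)) (block [Arith Add 11 11 4, Store 11 14, Arith Sub 13 13 4]) 3 (I v)"
    proof (rule hoare_block)
      fix r m assume I: "I (Suc v) r m"
      have "addr N + Suc (k - Suc v) \<le> B" using bound' \<open>v < k\<close> by (simp add: Q_eq)
      then show "wp B [Arith Add 11 11 4, Store 11 14, Arith Sub 13 13 4] (I v) r m"
        using I \<open>v < k\<close> unfolding I_def * by (auto simp: consts_ok_def less_Suc_eq)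
    qed simp
  qed (simp add: I_def)
  then show ?thesis
    by (rule hoare_conseq) (auto simp: I_def initial_mem)
qed

definition bfs_ok :: "'a list list \<Rightarrow> nat \<Rightarrow> nat \<Rightarrow> assertion" where
  "bfs_ok us h c r m \<longleftrightarrow> queue_ok us h c \<and> mem_ok us h c m \<and> consts_ok r \<and>
     r 10 = Q + 2 * length us"

lemma enqueue_root_correct:
  "hoare B (\<lambda>r m. consts_ok r \<and> (\<forall>i < addr N. m i = mem (initial_config xs) i) \<and> m (addr N) = 0 \<and>
      (\<forall>c<k. m (addr N + Suc c) = Suc (num []))) enqueue_root 6
    (\<lambda>r m. bfs_ok [[]] 0 0 r m \<and> r 9 = Q \<and> r 16 = 2)"
proof -
  have queue: "queue_ok [[]] 0 0" by (simp add: queue_ok_def Nil_state processed_def)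
  have "mem_ok [[]] 0 0 (m(Q := num [], Suc Q := N))"
    if low: "\<forall>i < addr N. m i = mem (initial_config xs) i"
      and virt: "\<forall>c<k. m (addr N + Suc c) = Suc (num [])" for m
  proof -
    let ?m = "m(Q := num [], Suc Q := N)"
    have same: "?m (addr (num u) + c) = mem (initial_config xs) (addr (num u) + c)"
      if "u \<in> S" "c \<le> k" for u c
    proof -
      have "addr (num u) + c < addr N" using addr_less[OF num_less[OF that(1)]] that(2) by simp
      then show ?thesis using low by (simp add: Q_eq)
    qed
    have "?m (addr (num u)) = (if u \<in> M then 1 else 0)" if "u \<in> S" for u
      using same[OF that, of 0] initial_flag[OF that] by simp
    moreover have "?m (addr (num u) + Suc (code a)) =
        (if processed [[]] 0 0 u a then Suc (num (\<delta> u a))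
         else if u @ [a] \<in> S then Suc (num (u @ [a])) else 0)" if "u \<in> S" "a \<in> A" for u a
      using same[OF that(1), of "Suc (code a)"] initial_cell[OF that] code_less[OF that(2)]
      by (simp add: processed_def)
    moreover have "?m (addr N + Suc c) = Suc (num [])" if "c < k" for c
      using virt that by (simp add: Q_eq)
    ultimately show ?thesis unfolding mem_ok_def by (simp add: failure_def)
  qed
  moreover have "Q + 2 \<le> B" using bound' card_pos by linarith
  ultimately show ?thesis
    unfolding enqueue_root_def using queue
    by (intro hoare_block) (auto simp: consts_ok_def bfs_ok_def)
qed

lemma process_letter_correct:
  assumes v: "v < k"
  shows "hoare B
    (\<lambda>r m. \<exists>us. bfs_ok us h (k - Suc v) r m \<and> h < length us \<and> r 9 = Q + 2 * Suc h \<and>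
      r 11 = addr (num (us ! h)) + (k - Suc v) \<and> r 12 = addr (failure (us ! h)) + (k - Suc v) \<and>
      r 13 = Suc v)
    process_letter 17
    (\<lambda>r m. \<exists>us. bfs_ok us h (k - v) r m \<and> h < length us \<and> r 9 = Q + 2 * Suc h \<and>
      r 11 = addr (num (us ! h)) + (k - v) \<and> r 12 = addr (failure (us ! h)) + (k - v) \<and>
      r 13 = v)"
  unfolding process_letter_def
proof (rule hoare_block)
  fix r m :: "nat \<Rightarrow> nat"
  assume r_le: "\<And>x. r x \<le> B" and m_le: "\<And>i. m i \<le> B"
  assume "\<exists>us. bfs_ok us h (k - Suc v) r m \<and> h < length us \<and> r 9 = Q + 2 * Suc h \<and>
      r 11 = addr (num (us ! h)) + (k - Suc v) \<and> r 12 = addr (failure (us ! h)) + (k - Suc v) \<and>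
      r 13 = Suc v"
  then obtain us where q: "queue_ok us h (k - Suc v)" and m: "mem_ok us h (k - Suc v) m"
    and c: "consts_ok r" and h: "h < length us" and r: "r 9 = Q + 2 * Suc h"
      "r 10 = Q + 2 * length us" "r 11 = addr (num (us ! h)) + (k - Suc v)"
      "r 12 = addr (failure (us ! h)) + (k - Suc v)" "r 13 = Suc v"
    by (auto simp: bfs_ok_def)
  define j where "j = k - Suc v"
  have j: "k - Suc v = j" "k - v = Suc j" "j < k" using v by (simp_all add: j_def)
  define u where "u = us ! h"
  define t where "t = m (addr (num u) + Suc j)"
  define d where "d = m (addr (failure u) + Suc j)"
  define us' where "us' = us @ (if u @ [decode j] \<in> S then [u @ [decode j]] else [])"
  define m' where "m' = m(addr (num u) + Suc j := (1 - t) * d + t,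
      Q + 2 * length us := t - 1, Suc (Q + 2 * length us) := d - 1)"
  note q = q[unfolded j(1)] and m = m[unfolded j(1)]
  have "queue_ok us' h (Suc j)" 
    by (rule queue_step(1)[OF q h j(3)]) (simp add: us'_def u_def)
  moreover have "mem_ok us' h (Suc j) m'"
    by (rule mem_step[OF q m h j(3)]) (simp_all add: us'_def u_def t_def d_def m'_def)
  \<comment> \<open>The queue pointer advances by two cells if \<open>t\<close> is positive and by
    none otherwise.\<close>
  moreover have len: "Suc (Suc (Q + 2 * length us)) - ((1 - t) + (1 - t)) = Q + 2 * length us'"
    using table_reads(1)[OF q m h j(3)] by (simp add: us'_def t_def u_def)
  moreover have us'_h: "us' ! h = u" "h < length us'" using h by (simp_all add: us'_def u_def nth_append)
  moreover have "u \<in> S" using q h by (auto simp: queue_ok_def u_def)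
  then have "num u \<le> N" "failure u \<le> N"
    using num_less longest_state by (auto simp: failure_def intro: less_imp_le)
  then have "addr (num u) + Suc j \<le> B" "addr (failure u) + Suc j \<le> B"
    using cell_less_Q[of _ "Suc j"] j(3) bound' by (force intro: less_imp_le)+
  moreover have "length us \<le> N" "length us' \<le> N"
    using q \<open>queue_ok us' h (Suc j)\<close> queue_length_le by blast+
  \<comment> \<open>The pair is written even if all \<open>N\<close> states are already queued, so
    addresses up to \<open>Q + 2 * N + 1\<close> must be allowed for.\<close>
  then have "Q + 2 * length us + 1 \<le> B" "Q + 2 * length us' \<le> B" using bound' by linarith+
  moreover have "m (Suc (addr (num u) + j)) = t" "m (Suc (addr (failure u) + j)) = d"
    by (simp_all add: t_def d_def)
  moreover have "Suc (Suc 0) - ((1 - t) + (1 - t)) \<le> B" using bound'(2) by linarith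
  \<comment> \<open>The product cannot overflow: the sum is \<open>d\<close> or \<open>t\<close>,
    both of them memory contents.\<close>
  moreover have "(1 - t) * d \<le> B" "(1 - t) * d + t \<le> B"
    using m_le t_def d_def by (cases t; simp)+
  ultimately show "wp B [Arith Add 11 11 4, Arith Add 12 12 4, Load 14 11, Load 15 12,
     Arith Sub 16 4 14, Arith Mul 17 16 15, Arith Add 17 17 14, Store 11 17,
     Arith Sub 14 14 4, Store 10 14, Arith Add 18 10 4, Arith Sub 15 15 4, Store 18 15,
     Arith Sub 16 4 16, Arith Add 16 16 16, Arith Add 10 10 16, Arith Sub 13 13 4]
     (\<lambda>r m. \<exists>us. bfs_ok us h (k - v) r m \<and> h < length us \<and> r 9 = Q + 2 * Suc h \<and>
      r 11 = addr (num (us ! h)) + (k - v) \<and> r 12 = addr (failure (us ! h)) + (k - v) \<and>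
      r 13 = v) r m"
    using c r unfolding j bfs_ok_def
    by (simp add: consts_ok_def u_def[symmetric]) (intro exI[of _ us'], simp add: m'_def)
qed simp

definition scan_inv :: "nat \<Rightarrow> nat \<Rightarrow> assertion" where
  "scan_inv h v r m \<longleftrightarrow> (\<exists>us. bfs_ok us h (k - v) r m \<and> h < length us \<and> r 9 = Q + 2 * Suc h \<and>
     r 11 = addr (num (us ! h)) + (k - v) \<and> r 12 = addr (failure (us ! h)) + (k - v) \<and> r 13 = v)"

lemma dequeue_correct:
  "hoare B (\<lambda>r m. \<exists>us. bfs_ok us h 0 r m \<and> h < length us \<and> r 9 = Q + 2 * h) dequeue 9 (scan_inv h k)"
  unfolding dequeue_def
proof (rule hoare_block)
  fix r m :: "nat \<Rightarrow> nat"
  assume "\<exists>us. bfs_ok us h 0 r m \<and> h < length us \<and> r 9 = Q + 2 * h"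
  then obtain us where q: "queue_ok us h 0" and m: "mem_ok us h 0 m"
    and c: "consts_ok r" and h: "h < length us" and r: "r 9 = Q + 2 * h" "r 10 = Q + 2 * length us"
    by (auto simp: bfs_ok_def)
  define u where "u = us ! h"
  have "u \<in> S" using q h by (auto simp: queue_ok_def u_def)
  then have "num u \<le> N" "failure u \<le> N"
    using num_less longest_state by (auto simp: failure_def intro: less_imp_le)
  then have "addr (num u) \<le> B" "addr (failure u) \<le> B"
    using cell_less_Q[of _ 0] bound' by (force intro: less_imp_le)+
  then have "num u * (1 + k) + 2 \<le> B" "failure u * (1 + k) + 2 \<le> B" by (simp_all add: addr_def)
  moreover from this have "num u * (1 + k) \<le> B" "failure u * (1 + k) \<le> B" by linarith+
  moreover have "m (Q + 2 * h) = num u" "m (Suc (Q + 2 * h)) = failure u"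
    using m h by (simp_all add: mem_ok_def u_def)
  moreover have "h < N" using queue_length_le[OF q] h by simp
  then have "Q + 2 * h + 2 \<le> B" using bound'(1) by simp
  ultimately show "wp B [Load 11 9, Arith Mul 11 11 5, Arith Add 11 11 8, Arith Add 9 9 4,
     Load 12 9, Arith Mul 12 12 5, Arith Add 12 12 8, Arith Add 9 9 4, Move 13 7] (scan_inv h k) r m"
    using c r q m h unfolding scan_inv_def bfs_ok_def
    by (simp add: consts_ok_def) (intro exI[of _ us], simp add: addr_def u_def)
qed simp

lemma breadth_first_correct:
  "hoare B (\<lambda>r m. bfs_ok [[]] 0 0 r m \<and> r 9 = Q \<and> r 16 = 2) breadth_first
    (N * ((9 + ((k * (17 + 2) + 1) + 1)) + 2) + 1)
    (\<lambda>r m. consts_ok r \<and> (\<exists>us. mem_ok us N 0 m \<and> set (take N us) = S))"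
proof -
  define I where "I v r m \<longleftrightarrow> (\<exists>us h. bfs_ok us h 0 r m \<and> r 9 = Q + 2 * h \<and>
      r 16 = 2 * (length us - h) \<and> h + v = N)" for v and r m :: "nat \<Rightarrow> nat"
  have cond: "r 16 = 0 \<longleftrightarrow> v = 0" if I: "I v r m" for v r m
  proof -
    obtain us h where *: "queue_ok us h 0" "r 16 = 2 * (length us - h)" "h + v = N"
      using I by (auto simp: I_def bfs_ok_def)
    then have "r 16 = 0 \<longleftrightarrow> h = length us" by (auto simp: queue_ok_def)
    then show ?thesis using queue_end[OF *(1)] *(3) by auto
  qed
  have "hoare B (I N) breadth_first (N * ((9 + ((k * (17 + 2) + 1) + 1)) + 2) + 1) (I 0)"
    unfolding breadth_first_def
  proof (rule hoare_loop)
    fix v assume v: "v < N"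
    define h where "h = N - Suc v"
    have scan: "hoare B (scan_inv h k) (loop 13 process_letter) (k * (17 + 2) + 1) (scan_inv h 0)"
    proof (rule hoare_loop)
      fix v assume "v < k"
      then show "hoare B (scan_inv h (Suc v)) process_letter 17 (scan_inv h v)"
        using process_letter_correct[of v h] by (simp add: scan_inv_def[abs_def])
    qed (auto simp: scan_inv_def)
    have close: "hoare B (scan_inv h 0) (block [Arith Sub 16 10 9]) 1 (I v)"
    proof (rule hoare_block)
      fix r m :: "nat \<Rightarrow> nat" assume "scan_inv h 0 r m"
      then obtain us where us: "queue_ok us h k" "mem_ok us h k m" "consts_ok r" "h < length us"
        "r 9 = Q + 2 * Suc h" "r 10 = Q + 2 * length us"
        by (auto simp: scan_inv_def bfs_ok_def)
      have "h + Suc v = N" using v by (simp add: h_def)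
      then show "wp B [Arith Sub 16 10 9] (I v) r m"
        using us queue_ok_next[OF us(1,4)] mem_ok_next[OF us(2,4)] unfolding I_def bfs_ok_def
        by (simp add: consts_ok_def) (intro exI[of _ us] exI[of _ "Suc h"], simp)
    qed simp
    have "\<exists>us. bfs_ok us h 0 r m \<and> h < length us \<and> r 9 = Q + 2 * h"
      if I: "I (Suc v) r m" for r m
    proof -
      obtain us h' where *: "bfs_ok us h' 0 r m" "r 9 = Q + 2 * h'"
        "r 16 = 2 * (length us - h')" "h' + Suc v = N"
        using I by (auto simp: I_def)
      then have "h' = h" by (simp add: h_def)
      moreover have "h' < length us" using cond[OF I] *(3) by simp
      ultimately show ?thesis using * by blast
    qed
    then show "hoare B (I (Suc v))
        (dequeue ;; loop 13 process_letter ;; block [Arith Sub 16 10 9])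
        (9 + ((k * (17 + 2) + 1) + 1)) (I v)"
      by (rule hoare_conseq[OF hoare_seq[OF dequeue_correct hoare_seq[OF scan close]]]) simp_all
  qed (rule cond)
  then show ?thesis
  proof (rule hoare_conseq)
    show "I N r m" if "bfs_ok [[]] 0 0 r m \<and> r 9 = Q \<and> r 16 = 2" for r m
      using that unfolding I_def by (intro exI[of _ "[[]]"] exI[of _ 0]) simp
    show "consts_ok r \<and> (\<exists>us. mem_ok us N 0 m \<and> set (take N us) = S)" if I: "I 0 r m" for r m
    proof -
      obtain us where us: "queue_ok us N 0" "mem_ok us N 0 m" "consts_ok r"
        using I by (auto simp: I_def bfs_ok_def)
      then have "N = length us" using queue_end by blast
      then show ?thesis using us queue_complete[of us] by (intro conjI exI[of _ us]) simp_all
    qed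
  qed simp
qed

definition table_ok :: "(nat \<Rightarrow> nat) \<Rightarrow> bool" where
  "table_ok m \<longleftrightarrow> (\<forall>u\<in>S. m (addr (num u)) = (if u \<in> M then 1 else 0) \<and>
     (\<forall>a\<in>A. m (addr (num u) + Suc (code a)) = Suc (num (\<delta> u a))))"

text \<open>The output array reuses the cells of the queue from \<open>Q\<close> on, and the walk
  reads only the table below them.\<close>

lemma table_ok_upd:
  assumes "Q \<le> i" shows "table_ok (m(i := x)) = table_ok m"
proof -
  have "addr (num u) + c \<noteq> i" if "u \<in> S" "c \<le> k" for u c
    using cell_less_Q[of "num u" c] num_less[OF that(1)] that(2) assms by simp
  from this[of _ 0] this[of _ "Suc (code _)"] show ?thesis
    by (simp add: table_ok_def code_less Suc_le_eq)
qed

lemma mem_ok_table_ok: "mem_ok us N 0 m \<Longrightarrow> set (take N us) = S \<Longrightarrow> table_ok m"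
  by (simp add: mem_ok_def table_ok_def processed_def)

subsection \<open>The walk\<close>

text \<open>\<open>R\<close> is a frame for the caller's facts about memory and about registers
  outside 10 to 14: the countdown of \<open>settle\<close>, or the letters already output.\<close>

lemma walk_step_correct:
  assumes frame: "\<And>r m x v. x \<in> {10..14} \<Longrightarrow> R (r(x := v)) m = R r m"
  shows "hoare B (\<lambda>r m. consts_ok r \<and> table_ok m \<and> r 10 = num (place s) \<and> R r m) walk_step (9 * k + 6)
    (\<lambda>r m. consts_ok r \<and> table_ok m \<and> r 10 = num (place (Suc s)) \<and> r 13 = Suc (code (out s)) \<and> R r m)"
proof -
  define u where "u = place s"
  define c where "c = next_code u"
  \<comment> \<open>The scan makes \<open>Suc c\<close> rounds. Before the first one no letter has
    been looked up, and register 14 is 1 merely to enter the loop; afterwards it holds the terminal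
    flag of the last target. Register 13 counts the letters tried and so ends one above the
    code.\<close>
  define I where "I v r m \<longleftrightarrow> consts_ok r \<and> table_ok m \<and> R r m \<and> v \<le> Suc c \<and> r 13 = Suc c - v \<and>
      r 11 = addr (num u) + (Suc c - v) \<and>
      (if v = Suc c then r 14 = 1 else r 12 = num (\<delta> u (decode (c - v))) \<and>
         r 14 = (if \<delta> u (decode (c - v)) \<in> M then 1 else 0))" for v and r m :: "nat \<Rightarrow> nat"
  have u: "u \<in> S" by (simp add: u_def place_state)
  have props: "c < k" "\<delta> u (decode c) \<notin> M" "\<And>j. j < c \<Longrightarrow> \<delta> u (decode j) \<in> M"
    using next_code_props[OF walk_factor[of s]]
    by (simp_all add: u_def c_def place_def next_letter_def)
  have frames: "R (r(10 := v)) m = R r m" "R (r(11 := v)) m = R r m" "R (r(12 := v)) m = R r m"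
    "R (r(13 := v)) m = R r m" "R (r(14 := v)) m = R r m" for r m v
    using frame by simp_all
  have upd: "consts_ok (r(10 := v)) = consts_ok r" "consts_ok (r(11 := v)) = consts_ok r"
    "consts_ok (r(12 := v)) = consts_ok r" "consts_ok (r(13 := v)) = consts_ok r"
    "consts_ok (r(14 := v)) = consts_ok r" for r v
    by (simp_all add: consts_ok_upd)
  have addr_B: "num v * (1 + k) + 2 \<le> B" if "v \<in> S" for v
    using cell_less_Q[of "num v" 0] num_less[OF that] bound' by (simp add: addr_def)
  have fst: "hoare B (\<lambda>r m. consts_ok r \<and> table_ok m \<and> r 10 = num u \<and> R r m)
      (block [Arith Mul 11 10 5, Arith Add 11 11 8, Const 13 0, Const 14 1]) 4 (I (Suc c))"
  proof (rule hoare_block)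
    fix r m :: "nat \<Rightarrow> nat" assume r: "consts_ok r \<and> table_ok m \<and> r 10 = num u \<and> R r m"
    then have "r 5 = 1 + k" "r 8 = 2" by (simp_all add: consts_ok_def)
    then show "wp B [Arith Mul 11 10 5, Arith Add 11 11 8, Const 13 0, Const 14 1] (I (Suc c)) r m"
      using r addr_B[OF u] bound' by (simp add: I_def frames upd addr_def)
  qed simp
  have cond: "r 14 = 0 \<longleftrightarrow> v = 0" if "I v r m" for v r m
    using that props(2) props(3)[of "c - v"] by (cases "v = 0") (auto simp: I_def split: if_splits)
  have mid: "hoare B (I (Suc c)) (loop 14 (block [Arith Add 11 11 4, Arith Add 13 13 4, Load 12 11,
      Arith Sub 12 12 4, Arith Mul 14 12 5, Arith Add 14 14 8, Load 14 14]))
      (Suc c * (7 + 2) + 1) (I 0)"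
  proof (rule hoare_loop)
    fix v assume v: "v < Suc c"
    define j where "j = c - v"
    have j: "Suc c - Suc v = j" "Suc c - v = Suc j" "j < k" "v \<noteq> Suc c"
      using v props(1) by (simp_all add: j_def)
    show "hoare B (I (Suc v)) (block [Arith Add 11 11 4, Arith Add 13 13 4, Load 12 11,
      Arith Sub 12 12 4, Arith Mul 14 12 5, Arith Add 14 14 8, Load 14 14]) 7 (I v)"
    proof (rule hoare_block)
      fix r m :: "nat \<Rightarrow> nat" assume I: "I (Suc v) r m"
      let ?v = "\<delta> u (decode j)"
      have r: "r 4 = 1" "r 5 = 1 + k" "r 8 = 2" "consts_ok r" "table_ok m" "R r m"
        "r 13 = j" "r 11 = addr (num u) + j"
        using I j(1) by (simp_all add: I_def consts_ok_def)
      have "?v \<in> S" by (simp add: \<delta>_def longest_state)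
      then have "m (addr (num ?v)) = (if ?v \<in> M then 1 else 0)" "num ?v * (1 + k) + 2 \<le> B"
        using r(5) addr_B by (auto simp: table_ok_def)
      moreover have "m (addr (num u) + Suc j) = Suc (num ?v)"
        using r(5) u decode_in[OF j(3)] code_decode[OF j(3)] by (metis table_ok_def)
      moreover have "addr (num u) + Suc j \<le> B" "Suc j \<le> B"
        using cell_less_Q[of "num u" "Suc j"] num_less[OF u] j(3) bound' by simp_all
      ultimately show "wp B [Arith Add 11 11 4, Arith Add 13 13 4, Load 12 11,
          Arith Sub 12 12 4, Arith Mul 14 12 5, Arith Add 14 14 8, Load 14 14] (I v) r m"
        using r v j by (simp add: I_def frames upd addr_def j_def[symmetric])
    qed simp
  qed (rule cond)
  have last: "hoare B (I 0) (block [Move 10 12]) 1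
    (\<lambda>r m. consts_ok r \<and> table_ok m \<and> r 10 = num (place (Suc s)) \<and> r 13 = Suc (code (out s)) \<and> R r m)"
  proof (rule hoare_block)
    fix r m assume "I 0 r m"
    then show "wp B [Move 10 12] (\<lambda>r m. consts_ok r \<and> table_ok m \<and> r 10 = num (place (Suc s)) \<and>
        r 13 = Suc (code (out s)) \<and> R r m) r m"
      by (simp add: I_def frames upd code_out place_Suc next_letter_def u_def c_def)
  qed simp
  show ?thesis
    unfolding walk_step_def
    by (rule hoare_conseq[OF hoare_seq[OF fst hoare_seq[OF mid last]]])
       (use props(1) in \<open>simp_all add: u_def\<close>)
qed

lemma settle_correct:
  "hoare B (\<lambda>r m. consts_ok r \<and> table_ok m \<and> r 10 = num [] \<and> r 9 = N) settle
    (N * (((9 * k + 6) + 1) + 2) + 1)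
    (\<lambda>r m. consts_ok r \<and> table_ok m \<and> r 10 = num (place N))"
proof -
  define I where "I v r m \<longleftrightarrow> consts_ok r \<and> table_ok m \<and> r 10 = num (place (N - v)) \<and> r 9 = v"
    for v and r m :: "nat \<Rightarrow> nat"
  have "hoare B (I N) settle (N * (((9 * k + 6) + 1) + 2) + 1) (I 0)"
    unfolding settle_def
  proof (rule hoare_loop)
    fix v assume "v < N"
    then have v: "Suc (N - Suc v) = N - v" by simp
    have "hoare B (I (Suc v)) walk_step (9 * k + 6) (\<lambda>r m. consts_ok r \<and> table_ok m \<and>
        r 10 = num (place (N - v)) \<and> r 9 = Suc v)"
      by (rule hoare_conseq[OF walk_step_correct[where s = "N - Suc v" and R = "\<lambda>r m. r 9 = Suc v"]])
         (auto simp: I_def v)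
    moreover have "hoare B (\<lambda>r m. consts_ok r \<and> table_ok m \<and>
        r 10 = num (place (N - v)) \<and> r 9 = Suc v) (block [Arith Sub 9 9 4]) 1 (I v)"
      by (rule hoare_block) (auto simp: I_def consts_ok_def)
    ultimately show "hoare B (I (Suc v)) (walk_step ;; block [Arith Sub 9 9 4]) ((9 * k + 6) + 1) (I v)"
      by (rule hoare_seq)
  qed (simp add: I_def)
  then show ?thesis by (rule hoare_conseq) (simp_all add: I_def place_0)
qed

lemma output_cycle_correct:
  "hoare B (\<lambda>r m. consts_ok r \<and> table_ok m \<and> r 10 = num (place N) \<and> r 15 = num (place N) \<and>
      r 0 = Q \<and> r 1 = 0 \<and> r 9 = 1) output_cycle
    (cycle_length * (((9 * k + 6) + 7) + 2) + 1)
    (\<lambda>r m. r 0 = Q \<and> r 1 = cycle_length \<and> (\<forall>i < cycle_length. m (Q + i) = code (out (N + i))))"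
proof -
  define l where "l = cycle_length"
  define R where "R j r m \<longleftrightarrow> r 15 = num (place N) \<and> r 0 = Q \<and> r 1 = j \<and>
      (\<forall>i<j. m (Q + i) = code (out (N + i)))" for j and r m :: "nat \<Rightarrow> nat"
  \<comment> \<open>With \<open>v\<close> rounds left, \<open>l - v\<close> letters are written. At
    the outset the walk stands on its starting place, so only the preset 1 in register 9 lets the
    loop begin.\<close>
  define I where "I v r m \<longleftrightarrow> consts_ok r \<and> table_ok m \<and> r 10 = num (place (N + (l - v))) \<and>
      R (l - v) r m \<and> (r 9 = 0 \<longleftrightarrow> v = 0)" for v and r m :: "nat \<Rightarrow> nat"
  have "hoare B (I l) output_cycle (l * (((9 * k + 6) + 7) + 2) + 1) (I 0)"
    unfolding output_cycle_def
  proof (rule hoare_loop)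
    fix v assume v: "v < l"
    define j where "j = l - Suc v"
    have j: "l - Suc v = j" "l - v = Suc j" "j < N"
      using v cycle_length_le_card by (simp_all add: j_def l_def)
    let ?after = "\<lambda>r m. consts_ok r \<and> table_ok m \<and> r 10 = num (place (Suc (N + j))) \<and>
        r 13 = Suc (code (out (N + j))) \<and> R j r m"
    have "hoare B (I (Suc v)) walk_step (9 * k + 6) ?after"
      by (rule hoare_conseq[OF walk_step_correct[where s = "N + j" and R = "R j"]])
         (auto simp: I_def j R_def)
    moreover have "hoare B ?after (block [Arith Sub 16 13 4, Arith Add 17 0 1, Store 17 16,
        Arith Add 1 1 4, Arith Sub 9 10 15, Arith Sub 17 15 10, Arith Add 9 9 17]) 7 (I v)"
    proof (rule hoare_block)
      fix r m assume r: "?after r m"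
      \<comment> \<open>Minimality of \<open>cycle_length\<close> excludes an earlier return, and
        injectivity of \<open>num\<close> lets the machine compare numbers instead of
        states.\<close>
      have returned: "num (place (N + Suc j)) = num (place N) \<longleftrightarrow> v = 0"
        using num_inj[OF place_state place_state] cycle_length_props(2)
          cycle_length_le[of "Suc j"] v by (auto simp: j_def l_def)
      have "num (place (N + Suc j)) \<le> N" "num (place N) \<le> N"
        using num_less[OF place_state] less_imp_le by blast+
      then have "num (place (N + Suc j)) - num (place N) + (num (place N) - num (place (N + Suc j))) \<le> B"
        using bound' by linarith
      moreover have "Q + j \<le> B" "Suc j \<le> B" using j(3) bound' by linarith+
      ultimately show "wp B [Arith Sub 16 13 4, Arith Add 17 0 1, Store 17 16,
        Arith Add 1 1 4, Arith Sub 9 10 15, Arith Sub 17 15 10, Arith Add 9 9 17] (I v) r m"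
        using r returned by (auto simp: I_def j R_def consts_ok_def table_ok_upd less_Suc_eq)
    qed simp
    ultimately show "hoare B (I (Suc v)) (walk_step ;; block [Arith Sub 16 13 4, Arith Add 17 0 1,
        Store 17 16, Arith Add 1 1 4, Arith Sub 9 10 15, Arith Sub 17 15 10, Arith Add 9 9 17])
        ((9 * k + 6) + 7) (I v)"
      by (rule hoare_seq)
  qed (simp add: I_def)
  then show ?thesis
    unfolding l_def[symmetric]
    by (rule hoare_conseq) (use cycle_length_props(1) in \<open>auto simp: I_def R_def l_def\<close>)
qed

lemma start_walk_correct:
  "hoare B (\<lambda>r m. consts_ok r \<and> (\<exists>us. mem_ok us N 0 m \<and> set (take N us) = S)) start_walk 2
    (\<lambda>r m. consts_ok r \<and> table_ok m \<and> r 10 = num [] \<and> r 9 = N)"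
  unfolding start_walk_def
  by (rule hoare_block) (auto simp: consts_ok_def intro: mem_ok_table_ok)

lemma start_output_correct:
  "hoare B (\<lambda>r m. consts_ok r \<and> table_ok m \<and> r 10 = num (place N)) start_output 4
    (\<lambda>r m. consts_ok r \<and> table_ok m \<and> r 10 = num (place N) \<and> r 15 = num (place N) \<and>
      r 0 = Q \<and> r 1 = 0 \<and> r 9 = 1)"
  unfolding start_output_def
  by (rule hoare_block) (use bound'(2) in \<open>auto simp: consts_ok_def\<close>)

section \<open>The whole program and its running time\<close>

lemmas reconstruct_correct =
  hoare_seq[OF initialise_correct hoare_seq[OF virtual_state_correct hoare_seq[OF enqueue_root_correct
    hoare_seq[OF breadth_first_correct hoare_seq[OF start_walk_correct hoare_seq[OF settle_correct
    hoare_seq[OF start_output_correct output_cycle_correct]]]]]], folded reconstruct_def]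

lemma reconstruct_computes:
  "\<exists>v\<in>circular_word w.
     computes_within (reconstruct k 0) B xs ((200 * (1 + k) * (1 + k)) * length w) (map code v)"
proof (rule bexI[OF _ cycle_word], rule hoare_computes_within[OF _ initial_fits])
  let ?ys = "map code (map out [N..<N + cycle_length])"
  let ?T = "14 + (k * 5 + 1 + (6 + (N * (9 + (k * (17 + 2) + 1 + 1) + 2) + 1 +
      (2 + (N * (9 * k + 6 + 1 + 2) + 1 + (4 + (cycle_length * (9 * k + 6 + 7 + 2) + 1)))))))"
  show "hoare B (\<lambda>r m. r = reg (initial_config xs) \<and> m = mem (initial_config xs)) (reconstruct k) ?T
      (\<lambda>r m. r 1 = length ?ys \<and> (\<forall>i < length ?ys. m (r 0 + i) = ?ys ! i))"
    by (rule hoare_conseq[OF reconstruct_correct]) simp_all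
  define n where "n = length w"
  have n: "1 \<le> n" "cycle_length = n" using Suc_leI[OF length_pos] cycle_length_eq by (simp_all add: n_def)
  have "?T = 30 + 5 * k + N * (28 * k + 22) + n * (9 * k + 15)"
    by (simp add: n(2) algebra_simps)
  also have "\<dots> \<le> (30 + 5 * k) * n + (3 * n * (1 + k)) * (28 * k + 22) + n * (9 * k + 15)"
    using n(1) card_states_le by (intro add_mono mult_le_mono1) (simp_all add: n_def)
  \<comment> \<open>The coefficient of \<open>n\<close> on the left is
    \<open>84 * k^2 + 164 * k + 111\<close>, well below \<open>200 * (1 + k)^2\<close>.\<close>
  also have "\<dots> \<le> (200 * (1 + k) * (1 + k)) * n" by (simp add: algebra_simps)
  finally show "?T \<le> (200 * (1 + k) * (1 + k)) * length w" by (simp add: n_def)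
qed

end

theorem mainTheorem4:
  fixes A :: "'a set" and code :: "'a \<Rightarrow> nat"
  assumes "finite A" and "bij_betw code A {..<card A}"
  shows "\<exists>P C D. \<forall>w xs.
    w \<in> lists A \<and> primitive_word w \<and>
    encodes_graph A code (trie (minimal_forbidden A (circular_factors w))) xs \<longrightarrow>
    (\<exists>v \<in> circular_word w.
       computes_within P (D * length xs ^ D) xs (C * length w) (map code v))"
proof (intro exI allI impI, elim conjE)
  fix w xs
  assume w: "w \<in> lists A" "primitive_word w"
    and "encodes_graph A code (trie (minimal_forbidden A (circular_factors w))) xs"
  then obtain num where num:
    "bij_betw num (trie_states (minimal_forbidden A (circular_factors w)))
      {..<card (trie_states (minimal_forbidden A (circular_factors w)))}"
    "length xs = 2 + card (trie_states (minimal_forbidden A (circular_factors w))) * (1 + card A)"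
    "xs ! 0 = card (trie_states (minimal_forbidden A (circular_factors w)))" "xs ! 1 = num []"
    and rows: "\<And>u. u \<in> trie_states (minimal_forbidden A (circular_factors w)) \<Longrightarrow>
      xs ! (2 + num u * (1 + card A)) = (if u \<in> minimal_forbidden A (circular_factors w) then 1 else 0) \<and>
      (\<forall>a\<in>A. xs ! (2 + num u * (1 + card A) + 1 + code a) =
        (if u @ [a] \<in> trie_states (minimal_forbidden A (circular_factors w)) then num (u @ [a]) + 1 else 0))"
    unfolding encodes_graph_def trie_def by auto
  \<comment> \<open>The witness \<open>D\<close> is both coefficient and exponent of the word bound.
    The machine needs \<open>4 * length xs\<close>, so \<open>D = 4\<close> is chosen and the power
    only has to dominate \<open>length xs\<close>.\<close>
  have "length xs ^ 1 \<le> length xs ^ 4" using num(2) by (intro power_increasing) simp_all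
  then interpret encoded_trie A w code num xs "4 * length xs ^ 4"
    using assms w num rows by unfold_locales auto
  show "\<exists>v\<in>circular_word w. computes_within (reconstruct (card A) 0) (4 * length xs ^ 4) xs
      ((200 * (1 + card A) * (1 + card A)) * length w) (map code v)"
    by (rule reconstruct_computes)
qed

end
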